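(* For all $f\in\mathbb R$, $0\le p\le 1$, $\lambda>0$, $\mathbb L(f,p,\lambda)$ is the smallest value of $F$ for which $\mathbb M(f,F,\lambda)\ge p$, in the sense that $$\mathbb L(f,p,\lambda)=\inf\{F\ge|f|:\ \mathbb M(f,F,\lambda)\ge p\}.$$ Moreover, for all $f\in\mathbb R$, $F\ge|f|$, $\lambda>0$, $\mathbb M(f,F,\lambda)$ is the largest value of $p$ such that $\mathbb L(f,p,\lambda)\le F$, in the sense that $$\mathbb M(f,F,\lambda)=\sup\{p\in[0,1]:\ \mathbb L(f,p,\lambda)\le F\}.$$
   Context: $\mathcal D$ denotes the standard collection of dyadic intervals of $\mathbb R$. For $I\in\mathcal D$, $I_-$ and $I_+$ are its left and right halves, $\mathbf 1_I$ its indicator function, and $|E|$ denotes Lebesgue measure. For integrable $\varphi$, $\langle\varphi\rangle_I=\frac1{|I|}\int_I\varphi\,dx$. Functions are real-valued. For $J\in\mathcal D$ the (localized) dyadic square function is given by $$S_J^2\varphi(x)=\sum_{I\in\mathcal D,\ I\subseteq J}|\Delta_I\varphi|^2\,\mathbf 1_I(x),\qquad \Delta_I\varphi=\tfrac12\big(\langle\varphi\rangle_{I_+}-\langle\varphi\rangle_{I_-}\big)\big(\mathbf 1_{I_+}-\mathbf 1_{I_-}\big).$$ For $f\in\mathbb R$, $F\ge|f|$, $\lambda>0$, $$\mathbb M(f,F,\lambda)=\sup\frac1{|J|}|\{x\in J:S_J^2\varphi(x)\ge\lambda\}|,$$ the supremum being over all integrable $\varphi$ supported in $J\in\mathcal D$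 with $\langle\varphi\rangle_J=f$ and $\langle|\varphi|\rangle_J=F$. For $f\in\mathbb R$, $0\le p\le1$, $\lambda>0$, $$\mathbb L(f,p,\lambda)=\inf\langle|\varphi|\rangle_J,$$ the infimum being over all integrable $\varphi$ supported in $J\in\mathcal D$ with $\langle\varphi\rangle_J=f$ and $\frac1{|J|}|\{x\in J:S_J^2\varphi(x)\ge\lambda\}|=p$. Neither quantity depends on the choice of $J$. *)

theory Defs
  imports "HOL-Analysis.Analysis"
begin

definition dyadic :: "real set set" where
  "dyadic = {{of_int k * 2 powi n ..< (of_int k + 1) * 2 powi n} | k n :: int. True}"

definition left_half :: "real set \<Rightarrow> real set" where
  "left_half I = {x \<in> I. x < (Inf I + Sup I) / 2}"

definition right_half :: "real set \<Rightarrow> real set" where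
  "right_half I = {x \<in> I. (Inf I + Sup I) / 2 \<le> x}"

definition avg :: "(real \<Rightarrow> real) \<Rightarrow> real set \<Rightarrow> real" where
  "avg \<phi> I = (LINT x:I|lebesgue. \<phi> x) / measure lebesgue I"

definition mart_diff :: "real set \<Rightarrow> (real \<Rightarrow> real) \<Rightarrow> real \<Rightarrow> real" where
  "mart_diff I \<phi> x = 1 / 2 * (avg \<phi> (right_half I) - avg \<phi> (left_half I))
     * (indicator (right_half I) x - indicator (left_half I) x)"

text \<open>The squared square function takes values in \<^typ>\<open>ennreal\<close>, because the series may
  diverge at some points.\<close>

definition sq_fun2 :: "real set \<Rightarrow> (real \<Rightarrow> real) \<Rightarrow> real \<Rightarrow> ennreal" where
  "sq_fun2 J \<phi> x =
     (\<Sum>\<^sub>\<infinity>I\<in>{I \<in> dyadic. I \<subseteq> J}. ennreal (\<bar>mart_diff I \<phi> x\<bar>\<^sup>2 * indicator I x))"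

definition level_frac :: "real set \<Rightarrow> (real \<Rightarrow> real) \<Rightarrow> real \<Rightarrow> real" where
  "level_frac J \<phi> l = measure lebesgue {x \<in> J. ennreal l \<le> sq_fun2 J \<phi> x} / measure lebesgue J"

definition integrable_supported :: "real set \<Rightarrow> (real \<Rightarrow> real) \<Rightarrow> bool" where
  "integrable_supported J \<phi> \<longleftrightarrow> integrable lebesgue \<phi> \<and> (\<forall>x. x \<notin> J \<longrightarrow> \<phi> x = 0)"

text \<open>The interval \<open>J\<close> is kept as an explicit parameter of both extremal functions; by
  translation and dilation their values do not depend on the choice of \<open>J \<in> dyadic\<close>.
  The real-valued \<open>Sup\<close> and \<open>Inf\<close> carry no junk values for \<open>l > 0\<close>, \<open>\<bar>f\<bar> \<le> F\<close> and
  \<open>0 \<le> p \<le> 1\<close>: the sets are then nonempty (for \<open>bellman_L\<close>, add to the constant \<open>f\<close> a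
  difference of height \<open>sqrt l\<close> on each of countably many disjoint dyadic intervals filling a
  proportion \<open>p\<close> of \<open>J\<close>), and they are bounded by \<open>1\<close> above and by \<open>\<bar>f\<bar>\<close> below,
  respectively.\<close>

definition bellman_M :: "real set \<Rightarrow> real \<Rightarrow> real \<Rightarrow> real \<Rightarrow> real" where
  "bellman_M J f F l = Sup {level_frac J \<phi> l | \<phi>.
     integrable_supported J \<phi> \<and> avg \<phi> J = f \<and> avg (\<lambda>x. \<bar>\<phi> x\<bar>) J = F}"

definition bellman_L :: "real set \<Rightarrow> real \<Rightarrow> real \<Rightarrow> real \<Rightarrow> real" where
  "bellman_L J f p l = Inf {avg (\<lambda>x. \<bar>\<phi> x\<bar>) J | \<phi>.
     integrable_supported J \<phi> \<and> avg \<phi> J = f \<and> level_frac J \<phi> l = p}"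

end

theory Submission imports Defs begin

text \<open>For fixed \<open>f\<close> consider the set of pairs \<open>(p, F)\<close> attained by functions of mean \<open>f\<close>. Placing scaled
  copies of two functions on disjoint dyadic intervals shows that it is convex. Replacing a function,
  near the points where its square function is below \<open>l\<close>, by its local means plus or minus
  \<open>sqrt l\<close> raises \<open>p\<close> to \<open>1\<close> at a cost of about \<open>sqrt l * (1 - p)\<close> in \<open>F\<close>. Together these give the
  monotonicity and continuity in \<open>p\<close>, and in \<open>F\<close> on \<open>\<bar>f\<bar> < F\<close>, under which the two optimization
  problems are inverse to each other. Right-continuity at \<open>F = \<bar>f\<bar>\<close> uses the weak-type (1,1) bound for the
  square function, which comes from a Bellman function.\<close>

section \<open>The binary tree of dyadic subintervals\<close>

text \<open>The obstacle is that \<open>bellman_L\<close> prescribes \<open>p\<close> exactly and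
  \<open>bellman_M\<close> prescribes \<open>F\<close> exactly, while suprema and infima need not be
  attained. A near-optimal function misses the prescribed value slightly and has to be corrected to
  it at small cost. Mixing with the constant \<open>f\<close>, which attains
  \<open>(0, |f|)\<close>, corrects downwards; mixing with a function of level \<open>1\<close>
  corrects upwards. A mixing ratio is in general not dyadic, so infinitely many pieces are needed.
  Equal means make mixing exact: tree intervals not inside a piece then contribute nothing to the
  square function. On the edge \<open>F = |f|\<close> mixing with the constant cannot lower
  \<open>F\<close>, because \<open>|f|\<close> is already the least possible value. A nearby
  function must lose its part of the wrong sign without losing much of its level set. That part is
  small only in the mean of its absolute value, so its square function is controlled by a weak-type
  estimate and not by an L2 identity.\<close>

definition ivl :: "real set \<Rightarrow> bool" where
  "ivl I \<longleftrightarrow> (\<exists>a b. a < b \<and> I = {a..<b})"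

lemma ivl_atLeastLessThan [simp]: "ivl {a..<b} \<longleftrightarrow> a < b"
proof
  assume "ivl {a..<b}"
  then obtain c d where "c < d" "{a..<b} = {c..<d}" by (auto simp: ivl_def)
  then have "{a..<b} \<noteq> {}" by simp
  then show "a < b" by simp
qed (auto simp: ivl_def)

lemma half_atLeastLessThan:
  assumes "a < b"
  shows "left_half {a..<b} = {a..<(a + b) / 2}" "right_half {a..<b} = {(a + b) / 2..<b}"
  using assms by (auto simp: left_half_def right_half_def)

lemma ivlE:
  assumes "ivl I"
  obtains a b where "a < b" "I = {a..<b}" "left_half I = {a..<(a + b) / 2}"
    "right_half I = {(a + b) / 2..<b}"
  using assms half_atLeastLessThan by (auto simp: ivl_def)

lemma ivl_half [simp]:
  assumes "ivl I" shows "ivl (left_half I)" "ivl (right_half I)"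
  using assms by (auto elim!: ivlE)

lemma half_Un: "ivl I \<Longrightarrow> left_half I \<union> right_half I = I"
  and half_Int: "left_half I \<inter> right_half I = {}"
  by (auto simp: left_half_def right_half_def)

lemma half_subset: "left_half I \<subseteq> I" "right_half I \<subseteq> I"
  by (auto simp: left_half_def right_half_def)

lemma half_psubset:
  assumes "ivl I" shows "\<not> I \<subseteq> left_half I" "\<not> I \<subseteq> right_half I"
  using assms by (auto elim!: ivlE simp: atLeastLessThan_subset_iff)

lemma ivl_sets [simp]: "ivl I \<Longrightarrow> I \<in> sets lebesgue"
  and ivl_nonempty: "ivl I \<Longrightarrow> I \<noteq> {}"
  and ivl_lmeasurable: "ivl I \<Longrightarrow> I \<in> lmeasurable"
  and ivl_measure_pos: "ivl I \<Longrightarrow> 0 < measure lebesgue I"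
  and measure_half: "ivl I \<Longrightarrow> measure lebesgue (left_half I) = measure lebesgue I / 2"
    "ivl I \<Longrightarrow> measure lebesgue (right_half I) = measure lebesgue I / 2"
  by (auto elim!: ivlE simp: fmeasurable_def field_simps)

text \<open>Generations \<open>0\<close> to \<open>n - 1\<close> below \<open>J\<close>. Halving an
  arbitrary interval lets inductions pass from \<open>J\<close> to its halves without carrying the
  integers in \<open>dyadic\<close>.\<close>

fun subs_upto :: "nat \<Rightarrow> real set \<Rightarrow> real set set" where
  "subs_upto 0 J = {}"
| "subs_upto (Suc n) J = insert J (subs_upto n (left_half J) \<union> subs_upto n (right_half J))"

definition subs :: "real set \<Rightarrow> real set set" where
  "subs J = (\<Union>n. subs_upto n J)"

lemma finite_subs_upto [simp]: "finite (subs_upto n J)"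
  by (induction n arbitrary: J) auto

lemma countable_subs: "countable (subs J)"
  unfolding subs_def by (rule countable_UN) (auto intro: countable_finite)

lemma subs_upto_subset: "I \<in> subs_upto n J \<Longrightarrow> I \<subseteq> J"
proof (induction n arbitrary: J)
  case (Suc n)
  then show ?case using half_subset[of J] by fastforce
qed simp

lemma subs_upto_ivl: "I \<in> subs_upto n J \<Longrightarrow> ivl J \<Longrightarrow> ivl I"
  by (induction n arbitrary: J) auto

lemma subs_subset: "I \<in> subs J \<Longrightarrow> I \<subseteq> J"
  and subs_ivl: "I \<in> subs J \<Longrightarrow> ivl J \<Longrightarrow> ivl I"
  unfolding subs_def using subs_upto_subset subs_upto_ivl by blast+

lemma subs_upto_Suc: "subs_upto n J \<subseteq> subs_upto (Suc n) J"
proof (induction n arbitrary: J)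
  case (Suc n)
  then show ?case
    using Suc[of "left_half J"] Suc[of "right_half J"] by auto
qed simp

lemma subs_upto_mono: "m \<le> n \<Longrightarrow> subs_upto m J \<subseteq> subs_upto n J"
  using lift_Suc_mono_le[of "\<lambda>n. subs_upto n J"] subs_upto_Suc by blast

lemma subs_rec: "subs J = insert J (subs (left_half J) \<union> subs (right_half J))"
proof -
  have "subs J = (\<Union>n. subs_upto (Suc n) J)"
    unfolding subs_def using subs_upto_Suc by blast
  then show ?thesis by (auto simp: subs_def)
qed

lemma subs_self [simp]: "J \<in> subs J" by (subst subs_rec) simp

lemma subs_upto_half:
  "I \<in> subs_upto n J \<Longrightarrow> left_half I \<in> subs_upto (Suc n) J \<and> right_half I \<in> subs_upto (Suc n) J"
proof (induction n arbitrary: J)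
  case (Suc n)
  then show ?case by (cases "I = J") (auto simp del: subs_upto.simps simp: subs_upto.simps(2)[of "Suc n"] subs_upto.simps(2)[of n])
qed simp

lemma subs_half: "I \<in> subs J \<Longrightarrow> left_half I \<in> subs J \<and> right_half I \<in> subs J"
  unfolding subs_def using subs_upto_half by blast

text \<open>An ancestor is at most as deep as its descendant. This turns maximality inside a finite
  set of generations into maximality in the whole tree.\<close>

lemma subs_upto_closed:
  assumes "ivl J" "I \<in> subs_upto n J" "K \<in> subs J" "I \<subseteq> K"
  shows "K \<in> subs_upto n J"
  using assms
proof (induction n arbitrary: J)
  case (Suc n)
  have ne: "I \<noteq> {}" using Suc.prems subs_upto_ivl ivl_nonempty by blast
  consider "I = J" | "I \<in> subs_upto n (left_half J)" | "I \<in> subs_upto n (right_half J)"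
    using Suc.prems by auto
  then show ?case
  proof cases
    case 1
    then show ?thesis using Suc.prems subs_subset by auto
  next
    case 2
    have "K = J \<or> K \<in> subs (left_half J) \<or> K \<in> subs (right_half J)"
      using Suc.prems(3) subs_rec by blast
    moreover have "K \<notin> subs (right_half J)"
      using 2 Suc.prems ne subs_subset subs_upto_subset half_Int[of J] by blast
    ultimately show ?thesis using Suc.IH[of "left_half J"] Suc.prems 2 by auto
  next
    case 3
    have "K = J \<or> K \<in> subs (left_half J) \<or> K \<in> subs (right_half J)"
      using Suc.prems(3) subs_rec by blast
    moreover have "K \<notin> subs (left_half J)"
      using 3 Suc.prems ne subs_subset subs_upto_subset half_Int[of J] by blast
    ultimately show ?thesis using Suc.IH[of "right_half J"] Suc.prems 3 by auto
  qed
qed simp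

lemma subs_nested:
  assumes "I \<in> subs J" "K \<in> subs J"
  shows "I \<subseteq> K \<or> K \<subseteq> I \<or> I \<inter> K = {}"
proof -
  have "I \<subseteq> K \<or> K \<subseteq> I \<or> I \<inter> K = {}"
    if "I \<in> subs_upto n J" "K \<in> subs J" for n
    using that
  proof (induction n arbitrary: J)
    case (Suc n)
    have K: "K = J \<or> K \<in> subs (left_half J) \<or> K \<in> subs (right_half J)"
      using Suc.prems(2) subs_rec by blast
    consider "I = J" | "I \<in> subs_upto n (left_half J)" | "I \<in> subs_upto n (right_half J)"
      using Suc.prems by auto
    then show ?case
    proof cases
      case 1
      then show ?thesis using Suc.prems subs_subset by auto
    next
      case 2
      then show ?thesis
        using K Suc.IH[of "left_half J"] half_Int[of J] half_subset[of J] subs_subset[of K] subs_upto_subset[OF 2]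
        by blast
    next
      case 3
      then show ?thesis
        using K Suc.IH[of "right_half J"] half_Int[of J] half_subset[of J] subs_subset[of K] subs_upto_subset[OF 3]
        by blast
    qed
  qed simp
  then show ?thesis using assms by (auto simp: subs_def)
qed

lemma subs_small:
  assumes "a < b" "x \<in> {a..<b}"
  shows "\<exists>c d. {c..<d} \<in> subs {a..<b} \<and> x \<in> {c..<d} \<and> d - c \<le> (b - a) / 2 ^ n"
  using assms
proof (induction n arbitrary: a b)
  case 0
  then show ?case by (intro exI[of _ a] exI[of _ b]) auto
next
  case (Suc n)
  note h = half_atLeastLessThan[OF Suc.prems(1)]
  have r: "subs {a..<b} = insert {a..<b} (subs {a..<(a + b) / 2} \<union> subs {(a + b) / 2..<b})"
    by (subst subs_rec) (simp add: h)
  consider "x \<in> {a..<(a + b) / 2}" | "x \<in> {(a + b) / 2..<b}"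
    using Suc.prems by fastforce
  then show ?case
  proof cases
    case 1
    have "(a + b) / 2 - a = (b - a) / 2" by (simp add: field_simps)
    then have "((a + b) / 2 - a) / 2 ^ n = (b - a) / 2 ^ Suc n" by simp
    moreover obtain c d where "{c..<d} \<in> subs {a..<(a + b) / 2}" "x \<in> {c..<d}"
      "d - c \<le> ((a + b) / 2 - a) / 2 ^ n"
      using Suc.IH[of a "(a + b) / 2"] 1 Suc.prems by auto
    ultimately show ?thesis unfolding r by (intro exI[of _ c] exI[of _ d]) simp
  next
    case 2
    have "b - (a + b) / 2 = (b - a) / 2" by (simp add: field_simps)
    then have "(b - (a + b) / 2) / 2 ^ n = (b - a) / 2 ^ Suc n"
      by (metis divide_divide_eq_left power_Suc)
    moreover obtain c d where "{c..<d} \<in> subs {(a + b) / 2..<b}" "x \<in> {c..<d}"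
      "d - c \<le> (b - (a + b) / 2) / 2 ^ n"
      using Suc.IH[of "(a + b) / 2" b] 2 Suc.prems by auto
    ultimately show ?thesis unfolding r by (intro exI[of _ c] exI[of _ d]) simp
  qed
qed

lemma subs_neighbourhood:
  assumes "ivl J" "x \<in> J" "open U" "x \<in> U"
  shows "\<exists>I\<in>subs J. x \<in> I \<and> I \<subseteq> U"
proof -
  obtain a b where J: "a < b" "J = {a..<b}" using assms by (auto simp: ivl_def)
  obtain e where e: "e > 0" "ball x e \<subseteq> U" using assms openE by blast
  obtain n where "(b - a) / e < 2 ^ n"
    using real_arch_pow[of 2 "(b - a) / e"] by auto
  then have n: "(b - a) / 2 ^ n < e" using e by (simp add: field_simps)
  obtain c d where cd: "{c..<d} \<in> subs J" "x \<in> {c..<d}" "d - c \<le> (b - a) / 2 ^ n"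
    using subs_small[of a b x n] J assms by auto
  have "{c..<d} \<subseteq> ball x e" using cd n by (auto simp: dist_real_def)
  then show ?thesis using cd e by blast
qed

text \<open>The maximal tree intervals inside \<open>U\<close>: nestedness makes distinct ones
  disjoint, and every point of \<open>U\<close> in \<open>J\<close> lies in some tree interval
  inside \<open>U\<close> because these shrink to the point. Empty sets pad the sequence, since the
  family may be finite.\<close>

lemma stopping_family:
  assumes J: "ivl J" and U: "open U"
  obtains K :: "nat \<Rightarrow> real set" where "disjoint_family K"
    "\<And>n. K n = {} \<or> K n \<in> subs J" "(\<Union>n. K n) = U \<inter> J"
proof -
  define \<K> where "\<K> = {I \<in> subs J. I \<subseteq> U \<and> (\<forall>I'\<in>subs J. I' \<subseteq> U \<longrightarrow> I \<subseteq> I' \<longrightarrow> I' = I)}"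
  have cnt: "countable \<K>"
    using countable_subs by (rule countable_subset[rotated]) (auto simp: \<K>_def)
  have disj: "I \<inter> I' = {}" if "I \<in> \<K>" "I' \<in> \<K>" "I \<noteq> I'" for I I'
    using that subs_nested[of I J I'] unfolding \<K>_def by blast
  have cover: "\<Union>\<K> = U \<inter> J"
  proof
    show "\<Union>\<K> \<subseteq> U \<inter> J" using subs_subset by (auto simp: \<K>_def)
  next
    show "U \<inter> J \<subseteq> \<Union>\<K>"
    proof
      fix x assume x: "x \<in> U \<inter> J"
      then obtain I where I: "I \<in> subs J" "x \<in> I" "I \<subseteq> U" using subs_neighbourhood J U by blast
      then obtain n where n: "I \<in> subs_upto n J" by (auto simp: subs_def)
      \<comment> \<open>All tree intervals containing \<open>I\<close> already belong to these
        finitely many generations, so a maximal element exists.\<close>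
      define S where "S = {I' \<in> subs_upto n J. I' \<subseteq> U}"
      have "finite S" "I \<in> S" using I n by (auto simp: S_def)
      then obtain M where M: "M \<in> S" "I \<subseteq> M" "\<forall>b\<in>S. M \<subseteq> b \<longrightarrow> M = b"
        using finite_has_maximal2[of S I] by blast
      have "M \<in> \<K>"
      proof -
        have "I' = M" if "I' \<in> subs J" "I' \<subseteq> U" "M \<subseteq> I'" for I'
          using that M subs_upto_closed[OF J, of M n I'] by (auto simp: S_def)
        then show ?thesis using M by (auto simp: \<K>_def S_def subs_def)
      qed
      then show "x \<in> \<Union>\<K>" using M I by blast
    qed
  qed
  define K where "K n = (if n \<in> to_nat_on \<K> ` \<K> then from_nat_into \<K> n else {})" for n
  have K: "K n = {} \<or> K n \<in> \<K>" for n
    using cnt by (auto simp: K_def)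
  have inj: "m = n" if "K m = K n" "K m \<noteq> {}" for m n
    using that cnt by (auto simp: K_def split: if_splits)
  have "disjoint_family K"
    unfolding disjoint_family_on_def using K disj inj by (metis Int_emptyI empty_iff)
  moreover have "K n = {} \<or> K n \<in> subs J" for n using K[of n] by (auto simp: \<K>_def)
  moreover have "(\<Union>n. K n) = \<Union>\<K>"
  proof
    show "(\<Union>n. K n) \<subseteq> \<Union>\<K>" using K by blast
    have "I = K (to_nat_on \<K> I)" if "I \<in> \<K>" for I
      using that cnt by (auto simp: K_def)
    then show "\<Union>\<K> \<subseteq> (\<Union>n. K n)" by blast
  qed
  ultimately show ?thesis using that cover by metis
qed

section \<open>Dyadic intervals as nodes of the halving tree\<close>

lemma dyadic_imp_ivl: "J \<in> dyadic \<Longrightarrow> ivl J"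
  by (auto simp: dyadic_def)

lemma dyadic_half:
  assumes "J \<in> dyadic" shows "left_half J \<in> dyadic" "right_half J \<in> dyadic"
proof -
  obtain k n :: int where J: "J = {of_int k * 2 powi n ..< (of_int k + 1) * 2 powi n}"
    using assms by (auto simp: dyadic_def)
  define h :: real where "h = 2 powi (n - 1)"
  have p: "(2::real) powi n = 2 * h" by (simp add: h_def power_int_diff)
  have h: "left_half J = {of_int (2 * k) * h ..< (of_int (2 * k) + 1) * h}"
    "right_half J = {of_int (2 * k + 1) * h ..< (of_int (2 * k + 1) + 1) * h}"
    unfolding J p by (simp_all add: half_atLeastLessThan algebra_simps add_divide_distrib h_def)
  show "left_half J \<in> dyadic" "right_half J \<in> dyadic" unfolding h h_def dyadic_def by blast+
qed

lemma subs_dyadic: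
  assumes "J \<in> dyadic" "I \<in> subs J" shows "I \<in> dyadic"
proof -
  have "I \<in> dyadic" if "I \<in> subs_upto n J" for n
    using that assms(1) by (induction n arbitrary: J) (auto dest: dyadic_half)
  then show ?thesis using assms by (auto simp: subs_def)
qed

text \<open>Induction on the difference \<open>d\<close> of the two scales: the small interval stays
  fixed while the large one is replaced by the half that contains it.\<close>

lemma dyadic_subset_imp_subs:
  fixes j k m :: int
  assumes "{of_int j * 2 powi m ..< (of_int j + 1) * 2 powi m} \<subseteq>
    {of_int k * 2 powi (m + int d) ..< (of_int k + 1) * 2 powi (m + int d) :: real}"
  shows "{of_int j * 2 powi m ..< (of_int j + 1) * 2 powi m} \<in>
    subs {of_int k * 2 powi (m + int d) ..< (of_int k + 1) * 2 powi (m + int d) :: real}"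
  using assms
proof (induction d arbitrary: k)
  case 0
  then have "k = j" by (auto simp: atLeastLessThan_subset_iff mult_le_cancel_right)
  then show ?case by simp
next
  case (Suc d)
  define h :: real where "h = 2 powi (m + int d)"
  have hp: "h > 0" by (simp add: h_def)
  have p: "(2::real) powi (m + int (Suc d)) = 2 * h"
    unfolding h_def by (simp add: power_int_add)
  have hm: "h = 2 ^ d * 2 powi m" by (simp add: h_def power_int_add)
  define J where "J = {of_int k * 2 powi (m + int (Suc d)) ..< (of_int k + 1) * 2 powi (m + int (Suc d)) :: real}"
  have halves: "left_half J = {of_int (2 * k) * h ..< (of_int (2 * k) + 1) * h}"
    "right_half J = {of_int (2 * k + 1) * h ..< (of_int (2 * k + 1) + 1) * h}"
    unfolding J_def p using hp
    by (simp_all add: half_atLeastLessThan algebra_simps add_divide_distrib)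
  have a: "of_int j * 2 powi m \<ge> real_of_int k * (2 * h)"
    "(of_int j + 1) * 2 powi m \<le> (real_of_int k + 1) * (2 * h)"
    using Suc.prems unfolding p by (auto simp: atLeastLessThan_subset_iff mult_le_cancel_right)
  then have "real_of_int k * 2 * 2 ^ d \<le> of_int j" "of_int j + 1 \<le> (real_of_int k + 1) * 2 * 2 ^ d"
    unfolding hm by (simp_all add: mult.assoc[symmetric])
  then have jk: "real_of_int (k * 2 * 2 ^ d) \<le> real_of_int j" "real_of_int (j + 1) \<le> real_of_int ((k + 1) * 2 * 2 ^ d)"
    by simp_all
  \<comment> \<open>The midpoint of the large interval is \<open>(2 * k + 1) * 2 ^ d\<close> times
    \<open>2 powi m\<close>, an integer multiple of the small length, so the small interval cannot
    straddle it.\<close>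
  consider "j + 1 \<le> (2 * k + 1) * 2 ^ d" | "(2 * k + 1) * 2 ^ d \<le> j" by linarith
  then show ?case
  proof cases
    case 1
    then have "real_of_int (j + 1) \<le> real_of_int ((2 * k + 1) * 2 ^ d)" by (simp only: of_int_le_iff)
    then have "(real_of_int j + 1) * 2 powi m \<le> (of_int (2 * k) + 1) * 2 ^ d * 2 powi m"
      by (intro mult_right_mono) auto
    then have "{of_int j * 2 powi m ..< (of_int j + 1) * 2 powi m} \<subseteq> left_half J"
      unfolding halves using a by (auto simp: hm algebra_simps)
    then have "{of_int j * 2 powi m ..< (of_int j + 1) * 2 powi m} \<in> subs (left_half J)"
      unfolding halves h_def by (rule Suc.IH)
    then show ?thesis unfolding J_def[symmetric] using subs_rec[of J] by blast
  next
    case 2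
    then have "real_of_int ((2 * k + 1) * 2 ^ d) \<le> real_of_int j" by (simp only: of_int_le_iff)
    then have "of_int (2 * k + 1) * 2 ^ d * 2 powi m \<le> real_of_int j * 2 powi m"
      by (intro mult_right_mono) auto
    then have "{of_int j * 2 powi m ..< (of_int j + 1) * 2 powi m} \<subseteq> right_half J"
      unfolding halves using a by (auto simp: hm algebra_simps)
    then have "{of_int j * 2 powi m ..< (of_int j + 1) * 2 powi m} \<in> subs (right_half J)"
      unfolding halves h_def by (rule Suc.IH)
    then show ?thesis unfolding J_def[symmetric] using subs_rec[of J] by blast
  qed
qed

text \<open>Converts the index set of \<open>sq_fun2\<close> into a tree, on which recursion over
  the two halves is available.\<close>

lemma dyadic_subsets_eq_subs:
  assumes "J \<in> dyadic" shows "{I \<in> dyadic. I \<subseteq> J} = subs J"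
proof
  show "subs J \<subseteq> {I \<in> dyadic. I \<subseteq> J}" using assms subs_dyadic subs_subset by blast
next
  show "{I \<in> dyadic. I \<subseteq> J} \<subseteq> subs J"
  proof
    fix I assume I: "I \<in> {I \<in> dyadic. I \<subseteq> J}"
    then obtain j m :: int where Ie: "I = {of_int j * 2 powi m ..< (of_int j + 1) * 2 powi m}"
      by (auto simp: dyadic_def)
    obtain k n :: int where Je: "J = {of_int k * 2 powi n ..< (of_int k + 1) * 2 powi n}"
      using assms by (auto simp: dyadic_def)
    have "measure lebesgue I \<le> measure lebesgue J"
      using I ivl_lmeasurable[OF dyadic_imp_ivl[OF assms]]
      by (intro measure_mono_fmeasurable) (auto simp: Ie)
    then have "(2::real) powi m \<le> 2 powi n" by (simp add: Ie Je algebra_simps)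
    then have "m \<le> n" using power_int_strict_increasing[of n m "2::real"] by fastforce
    then have "n = m + int (nat (n - m))" by simp
    then show "I \<in> subs J"
      using dyadic_subset_imp_subs[of j m k "nat (n - m)"] I unfolding Ie Je by simp
  qed
qed

section \<open>The square function along the tree\<close>

text \<open>The constant value of \<open>mart_diff I \<phi>\<close> on the right half; on the left
  half it has the opposite sign, so its square is the term of \<open>I\<close> in the square
  function.\<close>

definition half_diff :: "(real \<Rightarrow> real) \<Rightarrow> real set \<Rightarrow> real" where
  "half_diff \<phi> I = (avg \<phi> (right_half I) - avg \<phi> (left_half I)) / 2"

primrec sq_upto :: "nat \<Rightarrow> (real \<Rightarrow> real) \<Rightarrow> real set \<Rightarrow> real \<Rightarrow> real" where
  "sq_upto 0 \<phi> J x = 0"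
| "sq_upto (Suc n) \<phi> J x = (half_diff \<phi> J)\<^sup>2 * indicator J x
     + (sq_upto n \<phi> (left_half J) x + sq_upto n \<phi> (right_half J) x)"

definition sq_sup :: "(real \<Rightarrow> real) \<Rightarrow> real set \<Rightarrow> real \<Rightarrow> ennreal" where
  "sq_sup \<phi> J x = (SUP n. ennreal (sq_upto n \<phi> J x))"

lemma sq_upto_nonneg [simp]: "0 \<le> sq_upto n \<phi> J x"
  by (induction n arbitrary: J) auto

lemma sq_upto_outside: "x \<notin> J \<Longrightarrow> sq_upto n \<phi> J x = 0"
proof (induction n arbitrary: J)
  case (Suc n)
  then have "x \<notin> left_half J" "x \<notin> right_half J" using half_subset by blast+
  then show ?case using Suc by simp
qed simp

lemma sq_upto_left: "x \<in> left_half J \<Longrightarrow>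
    sq_upto (Suc n) \<phi> J x = (half_diff \<phi> J)\<^sup>2 + sq_upto n \<phi> (left_half J) x"
  and sq_upto_right: "x \<in> right_half J \<Longrightarrow>
    sq_upto (Suc n) \<phi> J x = (half_diff \<phi> J)\<^sup>2 + sq_upto n \<phi> (right_half J) x"
  using half_Int[of J] half_subset[of J] sq_upto_outside[of x "right_half J" n \<phi>]
    sq_upto_outside[of x "left_half J" n \<phi>]
  by (auto simp: indicator_def)

lemma sq_upto_eq_sum:
  assumes "ivl J"
  shows "sq_upto n \<phi> J x = (\<Sum>I\<in>subs_upto n J. (half_diff \<phi> I)\<^sup>2 * indicator I x)"
  using assms
proof (induction n arbitrary: J)
  case (Suc n)
  have l: "J \<notin> subs_upto n (left_half J)" and r: "J \<notin> subs_upto n (right_half J)"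
    using half_psubset[OF Suc.prems] subs_upto_subset by blast+
  have d: "subs_upto n (left_half J) \<inter> subs_upto n (right_half J) = {}"
  proof (rule ccontr)
    assume "subs_upto n (left_half J) \<inter> subs_upto n (right_half J) \<noteq> {}"
    then obtain I where I: "I \<in> subs_upto n (left_half J)" "I \<in> subs_upto n (right_half J)" by blast
    then have "I \<noteq> {}" using Suc.prems subs_upto_ivl ivl_nonempty ivl_half by blast
    moreover have "I \<subseteq> left_half J \<inter> right_half J" using I subs_upto_subset by blast
    ultimately show False using half_Int by blast
  qed
  define T where "T I = (half_diff \<phi> I)\<^sup>2 * indicator I x" for I
  have "sum T (subs_upto (Suc n) J) = T J + (sum T (subs_upto n (left_half J)) + sum T (subs_upto n (right_half J)))"
    using l r by (simp add: sum.union_disjoint[OF _ _ d])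
  then show ?case
    using Suc.IH[of "left_half J"] Suc.IH[of "right_half J"] Suc.prems
    unfolding T_def by simp
qed simp

lemma sq_upto_mono:
  assumes "ivl J" "m \<le> n" shows "sq_upto m \<phi> J x \<le> sq_upto n \<phi> J x"
  unfolding sq_upto_eq_sum[OF assms(1)]
  using subs_upto_mono[OF assms(2)] by (intro sum_mono2) auto

text \<open>A nonnegative \<open>infsum\<close> is the supremum over finite subfamilies, and the
  sets \<open>subs_upto n J\<close> are cofinal among these.\<close>

lemma sq_fun2_eq_sq_sup:
  assumes "J \<in> dyadic"
  shows "sq_fun2 J \<phi> x = sq_sup \<phi> J x"
proof -
  have J: "ivl J" using assms dyadic_imp_ivl by blast
  define t where "t I = ennreal ((half_diff \<phi> I)\<^sup>2 * indicator I x)" for I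
  have t: "ennreal (\<bar>mart_diff I \<phi> x\<bar>\<^sup>2 * indicator I x) = t I" if "I \<in> subs J" for I
  proof -
    have "x \<in> I \<longleftrightarrow> x \<in> left_half I \<or> x \<in> right_half I"
      using half_Un[OF subs_ivl[OF that J]] by blast
    then show ?thesis
      using half_Int[of I] by (auto simp: t_def mart_diff_def half_diff_def indicator_def power2_eq_square)
  qed
  have "sq_fun2 J \<phi> x = infsum t (subs J)"
    unfolding sq_fun2_def dyadic_subsets_eq_subs[OF assms] using t by (rule infsum_cong)
  also have "\<dots> = (SUP F\<in>{F. finite F \<and> F \<subseteq> subs J}. sum t F)"
    by (rule nonneg_infsum_complete) simp
  also have "\<dots> = (SUP n. sum t (subs_upto n J))"
  proof (rule antisym)
    show "(SUP F\<in>{F. finite F \<and> F \<subseteq> subs J}. sum t F) \<le> (SUP n. sum t (subs_upto n J))"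
    proof (rule SUP_least)
      fix F assume F: "F \<in> {F. finite F \<and> F \<subseteq> subs J}"
      have "\<exists>n. F \<subseteq> subs_upto n J"
      proof -
        have "finite F" "F \<subseteq> subs J" using F by auto
        then show ?thesis
        proof (induction F)
          case (insert I F)
          then obtain m n where "F \<subseteq> subs_upto m J" "I \<in> subs_upto n J" by (auto simp: subs_def)
          then have "insert I F \<subseteq> subs_upto (max m n) J"
            using subs_upto_mono[of m "max m n" J] subs_upto_mono[of n "max m n" J] by auto
          then show ?case by blast
        qed simp
      qed
      then obtain n where "F \<subseteq> subs_upto n J" by blast
      then have "sum t F \<le> sum t (subs_upto n J)" by (intro sum_mono2) auto
      then show "sum t F \<le> (SUP n. sum t (subs_upto n J))" by (rule SUP_upper2[rotated]) simp
    qed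
    show "(SUP n. sum t (subs_upto n J)) \<le> (SUP F\<in>{F. finite F \<and> F \<subseteq> subs J}. sum t F)"
      by (intro SUP_least SUP_upper) (auto simp: subs_def)
  qed
  also have "\<dots> = sq_sup \<phi> J x"
    unfolding sq_sup_def sq_upto_eq_sum[OF J] t_def by (simp add: sum_ennreal)
  finally show ?thesis .
qed

section \<open>Averages, half differences and their algebra\<close>

lemma avg_cong: "I \<in> sets lebesgue \<Longrightarrow> (\<And>x. x \<in> I \<Longrightarrow> \<phi> x = \<psi> x) \<Longrightarrow> avg \<phi> I = avg \<psi> I"
  unfolding avg_def using set_lebesgue_integral_cong[of I lebesgue \<phi> \<psi>] by simp

lemma avg_mult: "avg (\<lambda>x. c * \<phi> x) I = c * avg \<phi> I"
  by (simp add: avg_def)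

lemma integrable_imp_set_integrable: "integrable M (f :: _ \<Rightarrow> real) \<Longrightarrow> A \<in> sets M \<Longrightarrow> set_integrable M A f"
  unfolding set_integrable_def by (rule integrable_mult_indicator)

lemma avg_add:
  "integrable lebesgue \<phi> \<Longrightarrow> integrable lebesgue \<psi> \<Longrightarrow> I \<in> sets lebesgue \<Longrightarrow>
    avg (\<lambda>x. \<phi> x + \<psi> x) I = avg \<phi> I + avg \<psi> I"
  by (simp add: avg_def set_integral_add integrable_imp_set_integrable add_divide_distrib)

lemma avg_const: "ivl I \<Longrightarrow> avg (\<lambda>x. c) I = c"
  using ivl_measure_pos[of I] ivl_lmeasurable[of I]
  by (simp add: avg_def set_lebesgue_integral_def fmeasurable_def)

lemma avg_half:
  assumes "ivl I" "integrable lebesgue \<phi>"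
  shows "avg \<phi> I = (avg \<phi> (left_half I) + avg \<phi> (right_half I)) / 2"
proof -
  have "(LINT x:I|lebesgue. \<phi> x) = (LINT x:left_half I \<union> right_half I|lebesgue. \<phi> x)"
    by (simp add: half_Un assms)
  also have "\<dots> = (LINT x:left_half I|lebesgue. \<phi> x) + (LINT x:right_half I|lebesgue. \<phi> x)"
    using assms by (intro set_integral_Un half_Int integrable_imp_set_integrable) auto
  finally show ?thesis using ivl_measure_pos[OF assms(1)] by (simp add: avg_def measure_half assms field_simps)
qed

lemma abs_avg_le: "\<bar>avg \<phi> I\<bar> \<le> avg (\<lambda>x. \<bar>\<phi> x\<bar>) I"
proof -
  have "\<bar>LINT x:I|lebesgue. \<phi> x\<bar> \<le> (LINT x|lebesgue. \<bar>indicator I x *\<^sub>R \<phi> x\<bar>)"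
    unfolding set_lebesgue_integral_def by (rule integral_abs_bound)
  then show ?thesis
    unfolding avg_def set_lebesgue_integral_def
    by (simp add: abs_mult abs_divide divide_right_mono)
qed

lemma half_diff_mult: "half_diff (\<lambda>x. c * \<phi> x) I = c * half_diff \<phi> I"
  by (simp add: half_diff_def avg_mult algebra_simps)

lemma half_diff_add:
  "integrable lebesgue \<phi> \<Longrightarrow> integrable lebesgue \<psi> \<Longrightarrow> ivl I \<Longrightarrow>
    half_diff (\<lambda>x. \<phi> x + \<psi> x) I = half_diff \<phi> I + half_diff \<psi> I"
  by (simp add: half_diff_def avg_add field_simps)

lemma half_diff_cong:
  assumes "ivl I" "\<And>x. x \<in> I \<Longrightarrow> \<phi> x = \<psi> x" shows "half_diff \<phi> I = half_diff \<psi> I"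
proof -
  have "avg \<phi> (right_half I) = avg \<psi> (right_half I)" "avg \<phi> (left_half I) = avg \<psi> (left_half I)"
    using assms half_subset[of I] by (auto intro!: avg_cong)
  then show ?thesis by (simp add: half_diff_def)
qed

lemma sq_upto_mult: "sq_upto n (\<lambda>x. c * \<phi> x) J x = c\<^sup>2 * sq_upto n \<phi> J x"
  by (induction n arbitrary: J) (auto simp: half_diff_mult power_mult_distrib algebra_simps)

lemma sq_sup_mult: "sq_sup (\<lambda>x. c * \<phi> x) J x = ennreal (c\<^sup>2) * sq_sup \<phi> J x"
  unfolding sq_sup_def sq_upto_mult by (simp add: SUP_mult_left_ennreal ennreal_mult)

lemma sq_sup_uminus: "sq_sup (\<lambda>x. - \<phi> x) J x = sq_sup \<phi> J x"
  using sq_sup_mult[of "-1" \<phi> J x] by simp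

lemma sq_upto_cong:
  assumes "ivl J" "\<And>y. y \<in> J \<Longrightarrow> \<phi> y = \<psi> y" shows "sq_upto n \<phi> J x = sq_upto n \<psi> J x"
  using assms
proof (induction n arbitrary: J)
  case (Suc n)
  have "sq_upto n \<phi> (left_half J) x = sq_upto n \<psi> (left_half J) x"
    "sq_upto n \<phi> (right_half J) x = sq_upto n \<psi> (right_half J) x"
    using Suc.prems half_subset[of J] by (auto intro!: Suc.IH)
  then show ?case using half_diff_cong[of J \<phi> \<psi>] Suc.prems by simp
qed simp

lemma sq_sup_cong:
  "ivl J \<Longrightarrow> (\<And>y. y \<in> J \<Longrightarrow> \<phi> y = \<psi> y) \<Longrightarrow> sq_sup \<phi> J x = sq_sup \<psi> J x"
  unfolding sq_sup_def using sq_upto_cong[of J \<phi> \<psi>] by simp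

lemma sq_sup_eqI:
  assumes "ivl J" "\<And>I. I \<in> subs J \<Longrightarrow> x \<in> I \<Longrightarrow> half_diff \<phi> I = half_diff \<psi> I"
  shows "sq_sup \<phi> J x = sq_sup \<psi> J x"
proof -
  have "sq_upto n \<phi> J x = sq_upto n \<psi> J x" for n
    unfolding sq_upto_eq_sum[OF assms(1)]
  proof (rule sum.cong)
    fix I assume "I \<in> subs_upto n J"
    then have "I \<in> subs J" by (auto simp: subs_def)
    then show "(half_diff \<phi> I)\<^sup>2 * indicat_real I x = (half_diff \<psi> I)\<^sup>2 * indicat_real I x"
      using assms(2) by (cases "x \<in> I") auto
  qed simp
  then show ?thesis by (simp add: sq_sup_def)
qed

text \<open>Weighted Young inequality. The factor of \<open>u\<close> can be brought close to
  \<open>1\<close> while \<open>v\<close> absorbs a large one; the symmetric version with factor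
  \<open>2\<close> would lose a fixed proportion of the level.\<close>

lemma power2_add_le:
  fixes u v d :: real
  assumes "d > 0"
  shows "(u + v)\<^sup>2 \<le> (1 + d) * u\<^sup>2 + (1 + 1 / d) * v\<^sup>2"
proof -
  have "(1 + d) * u\<^sup>2 + (1 + 1 / d) * v\<^sup>2 - (u + v)\<^sup>2 = (d * u - v)\<^sup>2 / d"
    using assms by (simp add: field_simps power2_eq_square)
  moreover have "(d * u - v)\<^sup>2 / d \<ge> 0" using assms by simp
  ultimately show ?thesis by linarith
qed

lemma sq_sup_add_le:
  assumes "integrable lebesgue \<phi>" "integrable lebesgue \<psi>" "ivl J" "d > 0"
  shows "sq_sup (\<lambda>x. \<phi> x + \<psi> x) J x \<le>
    ennreal (1 + d) * sq_sup \<phi> J x + ennreal (1 + 1 / d) * sq_sup \<psi> J x"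
proof -
  have le: "sq_upto n (\<lambda>x. \<phi> x + \<psi> x) J x \<le> (1 + d) * sq_upto n \<phi> J x + (1 + 1 / d) * sq_upto n \<psi> J x" for n
    using assms(3)
  proof (induction n arbitrary: J)
    case (Suc n)
    have "(half_diff (\<lambda>x. \<phi> x + \<psi> x) J)\<^sup>2 * indicator J x
      \<le> ((1 + d) * (half_diff \<phi> J)\<^sup>2 + (1 + 1 / d) * (half_diff \<psi> J)\<^sup>2) * indicator J x"
      unfolding half_diff_add[OF assms(1,2) Suc.prems]
      by (intro mult_right_mono power2_add_le assms) auto
    then show ?case
      using Suc.IH[of "left_half J"] Suc.IH[of "right_half J"] Suc.prems by (simp add: distrib_left distrib_right mult.assoc)
  qed simp
  show ?thesis unfolding sq_sup_def[of "\<lambda>x. \<phi> x + \<psi> x"]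
  proof (rule SUP_least)
    fix n
    have "ennreal (sq_upto n (\<lambda>x. \<phi> x + \<psi> x) J x) \<le> ennreal ((1 + d) * sq_upto n \<phi> J x + (1 + 1 / d) * sq_upto n \<psi> J x)"
      using le by (intro ennreal_leI)
    also have "\<dots> = ennreal (1 + d) * ennreal (sq_upto n \<phi> J x) + ennreal (1 + 1 / d) * ennreal (sq_upto n \<psi> J x)"
      using assms by (simp add: ennreal_mult ennreal_plus del: ennreal_plus[symmetric])
    also have "\<dots> \<le> ennreal (1 + d) * sq_sup \<phi> J x + ennreal (1 + 1 / d) * sq_sup \<psi> J x"
      unfolding sq_sup_def by (intro add_mono mult_left_mono SUP_upper) auto
    finally show "ennreal (sq_upto n (\<lambda>x. \<phi> x + \<psi> x) J x) \<le>
      ennreal (1 + d) * sq_sup \<phi> J x + ennreal (1 + 1 / d) * sq_sup \<psi> J x" .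
  qed
qed

lemma sq_upto_measurable [measurable]:
  "ivl J \<Longrightarrow> (\<lambda>x. sq_upto n \<phi> J x) \<in> borel_measurable lebesgue"
proof (induction n arbitrary: J)
  case (Suc n)
  have [measurable]: "J \<in> sets lebesgue" using Suc.prems by simp
  have [measurable]: "(\<lambda>x. sq_upto n \<phi> (left_half J) x) \<in> borel_measurable lebesgue"
    "(\<lambda>x. sq_upto n \<phi> (right_half J) x) \<in> borel_measurable lebesgue" using Suc by auto
  show ?case by simp
qed (simp add: sq_upto.simps(1)[abs_def])

lemma sq_sup_measurable [measurable]:
  "ivl J \<Longrightarrow> (\<lambda>x. sq_sup \<phi> J x) \<in> borel_measurable lebesgue"
  unfolding sq_sup_def by (intro borel_measurable_SUP) auto

section \<open>Level sets and localization to a tree interval\<close>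

definition level_set :: "(real \<Rightarrow> real) \<Rightarrow> real set \<Rightarrow> real \<Rightarrow> real set" where
  "level_set \<phi> J l = {x \<in> J. ennreal l \<le> sq_sup \<phi> J x}"

lemma level_set_sets [simp]:
  assumes "ivl J" shows "level_set \<phi> J l \<in> sets lebesgue"
proof -
  have "{x \<in> space lebesgue. ennreal l \<le> sq_sup \<phi> J x} \<in> sets lebesgue"
    using sq_sup_measurable[OF assms] by measurable
  then show ?thesis using assms
    by (auto simp: level_set_def Collect_conj_eq intro!: sets.Int[of J])
qed

lemma level_set_subset: "level_set \<phi> J l \<subseteq> J" by (auto simp: level_set_def)

lemma level_frac_eq: "J \<in> dyadic \<Longrightarrow> level_frac J \<phi> l = measure lebesgue (level_set \<phi> J l) / measure lebesgue J"
  by (simp add: level_frac_def level_set_def sq_fun2_eq_sq_sup)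

text \<open>Passing from \<open>K\<close> to \<open>J\<close> only adds nonnegative terms; the depth
  of \<open>K\<close> below \<open>J\<close> merely shifts the number of generations.\<close>

lemma sq_sup_sub_le:
  assumes "ivl J" "K \<in> subs J" shows "sq_sup \<phi> K x \<le> sq_sup \<phi> J x"
proof -
  have le: "sq_upto n \<phi> K x \<le> sq_upto (n + m) \<phi> J x" if "K \<in> subs_upto m J" for n m
    using that assms(1)
  proof (induction m arbitrary: J)
    case (Suc m)
    consider "K = J" | "K \<in> subs_upto m (left_half J)" | "K \<in> subs_upto m (right_half J)"
      using Suc.prems by auto
    then show ?case
    proof cases
      case 1
      then show ?thesis using sq_upto_mono[OF Suc.prems(2), of n "n + Suc m"] by simp
    next
      case 2
      then show ?thesis using Suc.IH[OF 2] Suc.prems by (simp add: add_increasing add_increasing2)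
    next
      case 3
      then show ?thesis using Suc.IH[OF 3] Suc.prems by (simp add: add_increasing add_increasing2)
    qed
  qed simp
  obtain m where "K \<in> subs_upto m J" using assms by (auto simp: subs_def)
  then show ?thesis unfolding sq_sup_def by (auto intro!: SUP_mono ennreal_leI le)
qed

text \<open>The terms added in passing from \<open>K\<close> to \<open>J\<close> that are seen at
  \<open>x\<close> come from intervals not inside \<open>K\<close>, and these are assumed to vanish.
  This makes the level of a mixture of functions with equal means exact.\<close>

lemma sq_sup_sub_eq:
  assumes "ivl J" "K \<in> subs J" "x \<in> K"
    and z: "\<And>I. I \<in> subs J \<Longrightarrow> \<not> I \<subseteq> K \<Longrightarrow> x \<in> I \<Longrightarrow> half_diff \<phi> I = 0"
  shows "sq_sup \<phi> J x = sq_sup \<phi> K x"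
proof (rule antisym)
  have le: "sq_upto n \<phi> J x \<le> sq_upto n \<phi> K x" if "K \<in> subs_upto m J" for n m
    using that assms(1,3) z
  proof (induction m arbitrary: J n)
    case (Suc m)
    show ?case
    proof (cases "K = J \<or> n = 0")
      case False
      then obtain k where n: "n = Suc k" using not0_implies_Suc by blast
      have sub: "subs (left_half J) \<subseteq> subs J" "subs (right_half J) \<subseteq> subs J" using subs_rec[of J] by auto
      have "K \<subseteq> J" using Suc.prems(1) subs_upto_subset by blast
      then have "\<not> J \<subseteq> K" using False by blast
      then have d: "half_diff \<phi> J = 0"
        using Suc.prems(4)[OF subs_self] Suc.prems(3) \<open>K \<subseteq> J\<close> by blast
      consider "K \<in> subs_upto m (left_half J)" | "K \<in> subs_upto m (right_half J)"
        using Suc.prems False by auto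
      then have "sq_upto n \<phi> J x \<le> sq_upto k \<phi> K x"
      proof cases
        case 1
        then have "x \<in> left_half J" using Suc.prems subs_upto_subset by blast
        then show ?thesis unfolding n using Suc.IH[OF 1] Suc.prems sub by (subst sq_upto_left) (auto simp: d)
      next
        case 2
        then have "x \<in> right_half J" using Suc.prems subs_upto_subset by blast
        then show ?thesis unfolding n using Suc.IH[OF 2] Suc.prems sub by (subst sq_upto_right) (auto simp: d)
      qed
      also have "\<dots> \<le> sq_upto n \<phi> K x" using n Suc.prems subs_upto_ivl[of K] by (intro sq_upto_mono) auto
      finally show ?thesis .
    qed auto
  qed simp
  obtain m where "K \<in> subs_upto m J" using assms by (auto simp: subs_def)
  then show "sq_sup \<phi> J x \<le> sq_sup \<phi> K x" unfolding sq_sup_def by (auto intro!: SUP_mono ennreal_leI le)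
qed (use assms sq_sup_sub_le in auto)

section \<open>Affine copies\<close>

lemma avg_affine:
  assumes "r > 0"
  shows "avg (\<lambda>x. \<phi> (t + r * x)) {c..<d} = avg \<phi> {t + r * c..<t + r * d}"
proof -
  have ind: "indicator {t + r * c..<t + r * d} (t + r * x) = (indicator {c..<d} x :: real)" for x
    using assms by (auto simp: indicator_def)
  have "(LINT x:{t + r * c..<t + r * d}|lebesgue. \<phi> x) = r * (LINT x:{c..<d}|lebesgue. \<phi> (t + r * x))"
    unfolding set_lebesgue_integral_def
    using assms by (subst lebesgue_integral_real_affine[where c=r and t=t]) (simp_all add: ind)
  moreover have "measure lebesgue {t + r * c..<t + r * d} = r * measure lebesgue {c..<d}"
  proof (cases "c \<le> d")
    case True
    then show ?thesis using assms by (simp add: algebra_simps)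
  next
    case False
    then show ?thesis using assms by simp
  qed
  ultimately show ?thesis using assms by (simp add: avg_def)
qed

lemma sq_upto_affine:
  assumes "r > 0" "c < d"
  shows "sq_upto n (\<lambda>x. \<phi> (t + r * x)) {c..<d} x = sq_upto n \<phi> {t + r * c..<t + r * d} (t + r * x)"
  using assms(2)
proof (induction n arbitrary: c d)
  case (Suc n)
  have lt: "t + r * c < t + r * d" using Suc.prems assms by simp
  have m: "(t + r * c + (t + r * d)) / 2 = t + r * ((c + d) / 2)" by (simp add: field_simps)
  have ind: "indicator {t + r * c..<t + r * d} (t + r * x) = (indicator {c..<d} x :: real)"
    using assms by (auto simp: indicator_def)
  have hd: "half_diff (\<lambda>x. \<phi> (t + r * x)) {c..<d} = half_diff \<phi> {t + r * c..<t + r * d}"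
    unfolding half_diff_def half_atLeastLessThan[OF lt] half_atLeastLessThan[OF Suc.prems] m
    by (simp only: avg_affine[OF assms(1)])
  have "c < (c + d) / 2" "(c + d) / 2 < d" using Suc.prems by auto
  then show ?case
    unfolding sq_upto.simps half_atLeastLessThan[OF lt] half_atLeastLessThan[OF Suc.prems] m hd ind
    by (simp only: Suc.IH)
qed simp

lemma avg_indicator:
  assumes "E \<in> sets lebesgue" "I \<in> lmeasurable"
  shows "avg (indicator E) I = measure lebesgue (E \<inter> I) / measure lebesgue I"
proof -
  have "(\<lambda>x. indicator I x *\<^sub>R indicator E x :: real) = indicator (E \<inter> I)"
    by (auto simp: indicator_def fun_eq_iff)
  moreover have "E \<inter> I \<in> lmeasurable" using assms by (rule fmeasurable_Int_fmeasurable[of I lebesgue E, simplified inf_commute, rotated])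
  ultimately show ?thesis by (simp add: avg_def set_lebesgue_integral_def)
qed

lemma affine_copy:
  assumes J: "ivl J" and K: "ivl K" and \<phi>: "integrable lebesgue \<phi>"
  obtains \<psi> where "integrable lebesgue \<psi>" "avg \<psi> K = avg \<phi> J"
    "avg (\<lambda>x. \<bar>\<psi> x\<bar>) K = avg (\<lambda>x. \<bar>\<phi> x\<bar>) J"
    "measure lebesgue (level_set \<psi> K l) / measure lebesgue K =
     measure lebesgue (level_set \<phi> J l) / measure lebesgue J"
proof -
  obtain a b where ab: "a < b" "J = {a..<b}" using J by (auto simp: ivl_def)
  obtain c d where cd: "c < d" "K = {c..<d}" using K by (auto simp: ivl_def)
  \<comment> \<open>The increasing affine map \<open>t + r * x\<close> carries \<open>K\<close> onto
    \<open>J\<close>, and hence halves onto halves.\<close>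
  define r where "r = (b - a) / (d - c)"
  define t where "t = a - r * c"
  have r: "r > 0" using ab cd by (simp add: r_def)
  have Je: "J = {t + r * c..<t + r * d}"
  proof -
    have "r * (d - c) = b - a" using cd by (simp add: r_def)
    then show ?thesis unfolding ab t_def by (simp add: algebra_simps)
  qed
  define \<psi> where "\<psi> x = \<phi> (t + r * x)" for x
  have a1: "avg (\<lambda>x. g (t + r * x)) K = avg g J" for g
    unfolding cd(2) Je using r by (rule avg_affine)
  have s: "sq_sup \<psi> K x = sq_sup \<phi> J (t + r * x)" for x
    unfolding sq_sup_def \<psi>_def cd(2) Je using sq_upto_affine[OF r cd(1)] by simp
  have "t + r * x \<in> J \<longleftrightarrow> x \<in> K" for x unfolding Je cd(2) using r by auto
  then have i: "indicator (level_set \<psi> K l) x = (indicator (level_set \<phi> J l) (t + r * x) :: real)" for x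
    by (auto simp: indicator_def level_set_def s)
  \<comment> \<open>The proportion of a level set is the average of its indicator, so the change of
    variables for averages covers it too.\<close>
  have "avg (indicator (level_set \<psi> K l)) K = avg (indicator (level_set \<phi> J l)) J"
    unfolding a1[symmetric] using i by (simp add: i[abs_def] avg_def)
  then have "measure lebesgue (level_set \<psi> K l) / measure lebesgue K =
     measure lebesgue (level_set \<phi> J l) / measure lebesgue J"
    using J K level_set_subset by (simp add: avg_indicator ivl_lmeasurable inf.absorb1)
  moreover have "integrable lebesgue \<psi>"
    unfolding \<psi>_def using lebesgue_integrable_real_affine[OF \<phi>, of r t] r by simp
  ultimately show ?thesis
    using that a1[of \<phi>] a1[of "\<lambda>x. \<bar>\<phi> x\<bar>"] unfolding \<psi>_def by blast
qed

section \<open>The weak-type bound\<close>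

text \<open>The term \<open>s - x\<^sup>2\<close> is preserved when an interval is halved, and \<open>2 * F\<close> pays for the means
  that leave \<open>{-1<..<1}\<close>.\<close>

definition burkholder :: "real \<Rightarrow> real \<Rightarrow> real \<Rightarrow> real" where
  "burkholder x F s = (if \<bar>x\<bar> < 1 then min 1 (s + 2 * F - x\<^sup>2) else 1)"

lemma burkholder_le_1: "burkholder x F s \<le> 1"
  by (simp add: burkholder_def)

lemma burkholder_0_le: "\<bar>x\<bar> \<le> F \<Longrightarrow> burkholder x F 0 \<le> 2 * F"
  by (auto simp: burkholder_def intro: min.coboundedI2)

text \<open>If both means stay in \<open>{-1<..<1}\<close>, the parallelogram identity balances
  \<open>s - x\<^sup>2\<close> exactly. A mean outside has its value capped at \<open>1\<close>, and
  its absolute mean, at least \<open>1\<close>, pays for the defect.\<close>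

lemma burkholder_step:
  assumes "\<bar>x\<bar> \<le> F" "\<bar>y\<bar> \<le> G" "0 \<le> s"
  shows "(burkholder x F (s + ((y - x) / 2)\<^sup>2) + burkholder y G (s + ((y - x) / 2)\<^sup>2)) / 2
    \<le> burkholder ((x + y) / 2) ((F + G) / 2) s"
proof (cases "\<bar>(x + y) / 2\<bar> < 1")
  case True
  define m where "m = (x + y) / 2"
  define d where "d = (y - x) / 2"
  have xy: "x = m - d" "y = m + d" by (simp_all add: m_def d_def field_simps)
  have m: "\<bar>m\<bar> < 1" using True by (simp add: m_def)
  \<comment> \<open>Here \<open>u\<close> is the one mean that has left \<open>{-1<..<1}\<close>.
    Once the other mean is eliminated through \<open>m\<close>, this is what the mixed cases
    require, with \<open>2 * \<bar>u\<bar>\<close> bounded by twice the absolute mean. It is also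
    where the coefficient \<open>2\<close> of \<open>F\<close> in \<open>burkholder\<close> is
    used.\<close>
  have mixed: "1 - m\<^sup>2 + 2 * (m * u) \<le> 2 * \<bar>u\<bar>" if "1 \<le> \<bar>u\<bar>" for u
  proof -
    have "m * u \<le> \<bar>m\<bar> * \<bar>u\<bar>" by (metis abs_ge_self abs_mult)
    moreover have "(1 - \<bar>m\<bar>) * 1 \<le> (1 - \<bar>m\<bar>) * \<bar>u\<bar>" using m that by (intro mult_left_mono) auto
    moreover have "(1 - \<bar>m\<bar>) * (1 + \<bar>m\<bar>) \<le> (1 - \<bar>m\<bar>) * 2" using m by (intro mult_left_mono) auto
    moreover have "(1 - \<bar>m\<bar>) * (1 + \<bar>m\<bar>) = 1 - m\<^sup>2" by (simp add: algebra_simps power2_eq_square)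
    ultimately show ?thesis by (simp add: algebra_simps)
  qed
  have m2: "m\<^sup>2 \<le> 1" using m by (simp add: abs_square_le_1)
  define P where "P = burkholder x F (s + d\<^sup>2)"
  define Q where "Q = burkholder y G (s + d\<^sup>2)"
  have P1: "P \<le> 1" and Q1: "Q \<le> 1" by (simp_all add: P_def Q_def burkholder_le_1)
  have P2: "\<bar>x\<bar> < 1 \<Longrightarrow> P \<le> s + d\<^sup>2 + 2 * F - x\<^sup>2" and Q2: "\<bar>y\<bar> < 1 \<Longrightarrow> Q \<le> s + d\<^sup>2 + 2 * G - y\<^sup>2"
    by (simp_all add: P_def Q_def burkholder_def)
  have "(P + Q) / 2 \<le> s + (F + G) - m\<^sup>2"
  proof -
    consider "\<bar>x\<bar> < 1" "\<bar>y\<bar> < 1" | "1 \<le> \<bar>x\<bar>" "\<bar>y\<bar> < 1" | "\<bar>x\<bar> < 1" "1 \<le> \<bar>y\<bar>" | "1 \<le> \<bar>x\<bar>" "1 \<le> \<bar>y\<bar>"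
      by linarith
    then show ?thesis
    proof cases
      case 1
      have "x\<^sup>2 + y\<^sup>2 = 2 * m\<^sup>2 + 2 * d\<^sup>2" unfolding xy by (simp add: power2_eq_square algebra_simps)
      then show ?thesis using P2 Q2 1 by simp
    next
      case 2
      have "d\<^sup>2 - y\<^sup>2 + 2 * m\<^sup>2 = - m\<^sup>2 + 2 * (m * x)" unfolding xy by (simp add: power2_eq_square algebra_simps)
      then show ?thesis using P1 Q2 2 mixed[OF 2(1)] assms by simp
    next
      case 3
      have "d\<^sup>2 - x\<^sup>2 + 2 * m\<^sup>2 = - m\<^sup>2 + 2 * (m * y)" unfolding xy by (simp add: power2_eq_square algebra_simps)
      then show ?thesis using Q1 P2 3 mixed[OF 3(2)] assms by simp
    next
      case 4
      then show ?thesis using P1 Q1 m2 assms by simp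
    qed
  qed
  moreover have "burkholder m ((F + G) / 2) s = min 1 (s + (F + G) - m\<^sup>2)"
    using m unfolding burkholder_def by (simp del: distrib_left_numeral)
  ultimately show ?thesis using P1 Q1 unfolding m_def[symmetric] d_def[symmetric] P_def[symmetric] Q_def[symmetric]
    by simp
next
  case False
  then have "burkholder ((x + y) / 2) ((F + G) / 2) s = 1" by (simp add: burkholder_def)
  then show ?thesis using add_mono[OF burkholder_le_1[of x F] burkholder_le_1[of y G]] by simp
qed

text \<open>The parameter \<open>s\<close> carries the contribution of the coarser intervals:
  descending to a half adds the squared half difference to it, and \<open>burkholder_step\<close>
  closes the induction. The level is normalized to \<open>1\<close>.\<close>

lemma weak_type_aux:
  assumes "integrable lebesgue \<phi>" "ivl J" "0 \<le> s"
  shows "measure lebesgue {x \<in> J. 1 \<le> s + sq_upto n \<phi> J x}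
    \<le> measure lebesgue J * burkholder (avg \<phi> J) (avg (\<lambda>x. \<bar>\<phi> x\<bar>) J) s"
  using assms(2,3)
proof (induction n arbitrary: J s)
  case 0
  have F: "\<bar>avg \<phi> J\<bar> \<le> avg (\<lambda>x. \<bar>\<phi> x\<bar>) J" by (rule abs_avg_le)
  \<comment> \<open>Inside \<open>{-1<..<1}\<close> the square is at most the absolute value, hence
    at most \<open>F\<close>, so \<open>s + 2 * F - x\<^sup>2\<close> is at least
    \<open>s\<close>.\<close>
  have q: "(avg \<phi> J)\<^sup>2 \<le> \<bar>avg \<phi> J\<bar>" if "\<bar>avg \<phi> J\<bar> < 1"
    using that mult_left_le_one_le[of "\<bar>avg \<phi> J\<bar>" "\<bar>avg \<phi> J\<bar>"] by (simp add: power2_eq_square)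
  have "0 \<le> burkholder (avg \<phi> J) (avg (\<lambda>x. \<bar>\<phi> x\<bar>) J) s"
    using F q 0 by (auto simp: burkholder_def)
  moreover have "1 \<le> burkholder (avg \<phi> J) (avg (\<lambda>x. \<bar>\<phi> x\<bar>) J) s" if "1 \<le> s"
    using F q that by (auto simp: burkholder_def)
  ultimately show ?case
    using ivl_measure_pos[OF 0(1)] by (cases "1 \<le> s") auto
next
  case (Suc n)
  define L where "L = left_half J"
  define R where "R = right_half J"
  define d where "d = (half_diff \<phi> J)\<^sup>2"
  define E where "E H = {x \<in> H. 1 \<le> (s + d) + sq_upto n \<phi> H x}" for H
  have ivl: "ivl L" "ivl R" using Suc.prems by (auto simp: L_def R_def)
  have meas: "E H \<in> lmeasurable" if "ivl H" for H
  proof -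
    have [measurable]: "(\<lambda>x. sq_upto n \<phi> H x) \<in> borel_measurable lebesgue" using that by simp
    have "{x \<in> space lebesgue. 1 \<le> (s + d) + sq_upto n \<phi> H x} \<in> sets lebesgue" by measurable
    then have "H \<inter> {x. 1 \<le> (s + d) + sq_upto n \<phi> H x} \<in> lmeasurable"
      using ivl_lmeasurable[OF that] by (intro fmeasurable_Int_fmeasurable) auto
    moreover have "E H = H \<inter> {x. 1 \<le> (s + d) + sq_upto n \<phi> H x}" by (auto simp: E_def)
    ultimately show ?thesis by simp
  qed
  have "x \<in> J \<and> 1 \<le> s + sq_upto (Suc n) \<phi> J x \<longleftrightarrow> x \<in> E L \<union> E R" for x
  proof (cases "x \<in> L")
    case True
    moreover have "x \<in> J" "x \<notin> R" using True half_subset[of J] half_Int[of J] by (auto simp: L_def R_def)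
    ultimately show ?thesis
      using sq_upto_left[of x J n \<phi>] by (simp add: E_def L_def d_def add.assoc del: sq_upto.simps)
  next
    case False
    then have "x \<in> J \<longleftrightarrow> x \<in> R" using half_Un[OF Suc.prems(1)] by (auto simp: L_def R_def)
    then show ?thesis
      using False sq_upto_right[of x J n \<phi>] by (auto simp: E_def R_def d_def add.assoc simp del: sq_upto.simps)
  qed
  then have "{x \<in> J. 1 \<le> s + sq_upto (Suc n) \<phi> J x} = E L \<union> E R" by blast
  then have "measure lebesgue {x \<in> J. 1 \<le> s + sq_upto (Suc n) \<phi> J x}
      \<le> measure lebesgue (E L) + measure lebesgue (E R)"
    using meas ivl by (simp add: measure_Un_le)
  also have "\<dots> \<le> measure lebesgue L * burkholder (avg \<phi> L) (avg (\<lambda>x. \<bar>\<phi> x\<bar>) L) (s + d)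
      + measure lebesgue R * burkholder (avg \<phi> R) (avg (\<lambda>x. \<bar>\<phi> x\<bar>) R) (s + d)"
    unfolding E_def using ivl Suc.prems by (intro add_mono Suc.IH) (auto simp: d_def)
  also have "\<dots> = measure lebesgue J * ((burkholder (avg \<phi> L) (avg (\<lambda>x. \<bar>\<phi> x\<bar>) L) (s + d)
      + burkholder (avg \<phi> R) (avg (\<lambda>x. \<bar>\<phi> x\<bar>) R) (s + d)) / 2)"
    using Suc.prems by (simp add: L_def R_def measure_half algebra_simps)
  also have "\<dots> \<le> measure lebesgue J * burkholder (avg \<phi> J) (avg (\<lambda>x. \<bar>\<phi> x\<bar>) J) s"
    using burkholder_step[OF abs_avg_le abs_avg_le Suc.prems(2), of \<phi> L \<phi> R]
    unfolding avg_half[OF Suc.prems(1) assms(1)] avg_half[OF Suc.prems(1) integrable_abs[OF assms(1)]]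
      d_def half_diff_def L_def R_def
    by (rule mult_left_mono) simp
  finally show ?case .
qed

text \<open>Truncated square functions are bounded by \<open>weak_type_aux\<close> after rescaling;
  their level sets increase and cover the level set of the full one.\<close>

lemma weak_type:
  assumes "integrable lebesgue \<phi>" "ivl J" "0 < l"
  shows "measure lebesgue (level_set \<phi> J l) / measure lebesgue J \<le> 4 * avg (\<lambda>x. \<bar>\<phi> x\<bar>) J / sqrt l"
proof -
  \<comment> \<open>A supremum at least \<open>l\<close> need not be reached by a partial sum, but
    some partial sum exceeds \<open>l / 4\<close>. Scaling by \<open>2 / sqrt l\<close> moves the
    level \<open>l / 4\<close> to \<open>1\<close>; with the factor \<open>2\<close> of
    \<open>burkholder_0_le\<close> this gives the constant \<open>4\<close>.\<close>
  define c where "c = 2 / sqrt l"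
  define E where "E n = {x \<in> J. 1 \<le> 0 + sq_upto n (\<lambda>x. c * \<phi> x) J x}" for n
  define C where "C = 4 * avg (\<lambda>x. \<bar>\<phi> x\<bar>) J / sqrt l"
  have c: "c > 0" "c\<^sup>2 = 4 / l" using assms by (simp_all add: c_def power_divide)
  have E: "E n \<in> sets lebesgue" for n
  proof -
    have [measurable]: "(\<lambda>x. sq_upto n (\<lambda>x. c * \<phi> x) J x) \<in> borel_measurable lebesgue" using assms by simp
    have "{x \<in> space lebesgue. 1 \<le> 0 + sq_upto n (\<lambda>x. c * \<phi> x) J x} \<in> sets lebesgue" by measurable
    then have "J \<inter> {x. 1 \<le> 0 + sq_upto n (\<lambda>x. c * \<phi> x) J x} \<in> sets lebesgue"
      using assms by (intro sets.Int) auto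
    moreover have "E n = J \<inter> {x. 1 \<le> 0 + sq_upto n (\<lambda>x. c * \<phi> x) J x}" by (auto simp: E_def)
    ultimately show ?thesis by simp
  qed
  have b: "measure lebesgue (E n) \<le> measure lebesgue J * C" for n
  proof -
    have "measure lebesgue (E n) \<le> measure lebesgue J *
        burkholder (avg (\<lambda>x. c * \<phi> x) J) (avg (\<lambda>x. \<bar>c * \<phi> x\<bar>) J) 0"
      unfolding E_def using assms by (intro weak_type_aux) auto
    also have "\<dots> \<le> measure lebesgue J * (2 * avg (\<lambda>x. \<bar>c * \<phi> x\<bar>) J)"
      using abs_avg_le by (intro mult_left_mono burkholder_0_le) auto
    also have "avg (\<lambda>x. \<bar>c * \<phi> x\<bar>) J = c * avg (\<lambda>x. \<bar>\<phi> x\<bar>) J"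
      using c by (simp add: abs_mult avg_mult)
    finally show ?thesis by (simp add: C_def c_def)
  qed
  have sub: "level_set \<phi> J l \<subseteq> (\<Union>n. E n)"
  proof
    fix x assume x: "x \<in> level_set \<phi> J l"
    have "ennreal (l / 4) < ennreal l" using assms by (simp add: ennreal_less_iff)
    also have "\<dots> \<le> sq_sup \<phi> J x" using x by (simp add: level_set_def)
    finally obtain n where "ennreal (l / 4) < ennreal (sq_upto n \<phi> J x)"
      unfolding sq_sup_def less_SUP_iff by blast
    then have "l / 4 < sq_upto n \<phi> J x" using assms by (simp add: ennreal_less_iff)
    then have "x \<in> E n" using x assms by (simp add: E_def sq_upto_mult c level_set_def field_simps)
    then show "x \<in> (\<Union>n. E n)" by blast
  qed
  have "(\<Union>n. E n) \<subseteq> J" by (auto simp: E_def)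
  then have lm: "(\<Union>n. E n) \<in> lmeasurable"
    using fmeasurableI2[OF ivl_lmeasurable[OF assms(2)]] E by blast
  have "incseq E"
  proof (rule incseq_SucI)
    fix n
    have "sq_upto n (\<lambda>x. c * \<phi> x) J x \<le> sq_upto (Suc n) (\<lambda>x. c * \<phi> x) J x" for x
      using assms(2) by (rule sq_upto_mono) simp
    then show "E n \<subseteq> E (Suc n)" unfolding E_def by (smt (verit) Collect_mono)
  qed
  then have "(\<lambda>n. measure lebesgue (E n)) \<longlonglongrightarrow> measure lebesgue (\<Union>n. E n)"
    using E fmeasurableD2[OF lm] by (intro Lim_measure_incseq) auto
  then have "measure lebesgue (\<Union>n. E n) \<le> measure lebesgue J * C"
    by (rule LIMSEQ_le_const2) (use b in auto)
  moreover have "measure lebesgue (level_set \<phi> J l) \<le> measure lebesgue (\<Union>n. E n)"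
    using sub lm assms by (intro measure_mono_fmeasurable) auto
  ultimately show ?thesis
    using ivl_measure_pos[OF assms(2)] unfolding C_def[symmetric] by (simp add: field_simps)
qed

section \<open>Gluing along disjoint intervals\<close>

lemma summable_set_integral:
  fixes h :: "'a \<Rightarrow> real"
  assumes h: "integrable M h" and K: "\<And>n. K n \<in> sets M" "disjoint_family K"
  shows "summable (\<lambda>n. LINT x:K n|M. \<bar>h x\<bar>)"
proof (rule summableI_nonneg_bounded)
  show "0 \<le> (LINT x:K n|M. \<bar>h x\<bar>)" for n
    by (simp add: set_lebesgue_integral_def)
  fix N
  have "(\<Sum>n<N. LINT x:K n|M. \<bar>h x\<bar>) = (LINT x:(\<Union>n<N. K n)|M. \<bar>h x\<bar>)"
    using assms by (intro set_integral_finite_Union[symmetric])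
      (auto simp: integrable_imp_set_integrable disjoint_family_on_def)
  also have "\<dots> \<le> (LINT x|M. \<bar>h x\<bar>)"
    unfolding set_lebesgue_integral_def using assms
    by (intro integral_mono integrable_mult_indicator) (auto simp: indicator_def sets.finite_UN)
  finally show "(\<Sum>n<N. LINT x:K n|M. \<bar>h x\<bar>) \<le> (LINT x|M. \<bar>h x\<bar>)" .
qed

text \<open>An inequality suffices as the basic form, since equalities follow by applying it to a
  function and to its negative. The condition off the pieces is only almost everywhere because the
  pieces of a mixture miss a point of the interval.\<close>

lemma integral_nonpos_of_pieces:
  fixes h :: "'a \<Rightarrow> real"
  assumes h: "integrable M h" and K: "\<And>n::nat. K n \<in> sets M" "disjoint_family K"
    and le: "\<And>n. (LINT x:K n|M. h x) \<le> 0" and off: "AE x in M. x \<notin> (\<Union>n. K n) \<longrightarrow> h x \<le> 0"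
  shows "(LINT x|M. h x) \<le> 0"
proof -
  define U where "U = (\<Union>n. K n)"
  have U: "U \<in> sets M" using K by (auto simp: U_def)
  have "(LINT x:U|M. h x) = (\<Sum>n. (LINT x:K n|M. h x))"
    unfolding U_def using assms U
    by (intro lebesgue_integral_countable_add)
      (auto simp: disjoint_family_on_def U_def intro!: integrable_imp_set_integrable)
  moreover have "summable (\<lambda>n. LINT x:K n|M. h x)"
  proof (rule summable_comparison_test')
    show "summable (\<lambda>n. LINT x:K n|M. \<bar>h x\<bar>)" using h K by (rule summable_set_integral)
    show "norm (LINT x:K n|M. h x) \<le> (LINT x:K n|M. \<bar>h x\<bar>)" for n
      using integral_abs_bound[of M "\<lambda>x. indicator (K n) x *\<^sub>R h x"]
      by (simp add: set_lebesgue_integral_def abs_mult)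
  qed
  ultimately have 1: "(LINT x:U|M. h x) \<le> 0" using le suminf_le[of "\<lambda>n. LINT x:K n|M. h x" "\<lambda>_. 0"] by simp
  have "AE x in M. 0 \<le> - (indicator (space M - U) x *\<^sub>R h x)"
    using off by (auto simp: U_def indicator_def)
  then have "0 \<le> (LINT x|M. - (indicator (space M - U) x *\<^sub>R h x))"
    by (rule integral_nonneg_AE)
  then have 2: "(LINT x:space M - U|M. h x) \<le> 0"
    unfolding set_lebesgue_integral_def by simp
  have "(LINT x|M. h x) = (LINT x:U \<union> (space M - U)|M. h x)"
    using U sets.sets_into_space[OF U] by (subst Un_Diff_cancel) (simp add: Un_absorb1 set_integral_space h)
  also have "\<dots> = (LINT x:U|M. h x) + (LINT x:space M - U|M. h x)"
    using U h by (intro set_integral_Un integrable_imp_set_integrable) auto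
  finally show ?thesis using 1 2 by simp
qed

text \<open>At each point at most one term of the series is nonzero, so the summed integrals over
  the pieces are the only integrability condition.\<close>

lemma glue_pieces:
  fixes g :: "nat \<Rightarrow> 'a \<Rightarrow> real"
  assumes K: "\<And>n. K n \<in> sets M" "disjoint_family K"
    and g: "\<And>n. integrable M (g n)" "summable (\<lambda>n. LINT x:K n|M. \<bar>g n x\<bar>)"
    and \<phi>: "integrable M \<phi>"
  obtains \<psi> where "integrable M \<psi>" "\<And>n x. x \<in> K n \<Longrightarrow> \<psi> x = g n x"
    "\<And>x. x \<in> space M \<Longrightarrow> x \<notin> (\<Union>n. K n) \<Longrightarrow> \<psi> x = \<phi> x"
proof -
  define \<psi> where "\<psi> x = (\<Sum>n. indicator (K n) x *\<^sub>R g n x) + indicator (space M - (\<Union>n. K n)) x *\<^sub>R \<phi> x" for x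
  have uniq: "m = n" if "x \<in> K m" "x \<in> K n" for x m n
    using that K(2) by (auto simp: disjoint_family_on_def)
  have at: "(\<lambda>m. indicator (K m) x *\<^sub>R g m x) = (\<lambda>m. if m = n then g n x else 0)" if "x \<in> K n" for n x
    using that uniq by (auto simp: indicator_def fun_eq_iff)
  have off: "(\<lambda>m. indicator (K m) x *\<^sub>R g m x) = (\<lambda>m. 0)" if "x \<notin> (\<Union>n. K n)" for x
    using that by (auto simp: indicator_def)
  have "integrable M (\<lambda>x. \<Sum>n. indicator (K n) x *\<^sub>R g n x)"
  proof (rule integrable_suminf)
    show "integrable M (\<lambda>x. indicator (K n) x *\<^sub>R g n x)" for n
      using K g by (intro integrable_mult_indicator)
    show "AE x in M. summable (\<lambda>n. norm (indicator (K n) x *\<^sub>R g n x))"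
    proof (rule AE_I2)
      fix x
      have "finite {n. x \<in> K n}"
      proof (cases "\<exists>n. x \<in> K n")
        case True
        then obtain n where "x \<in> K n" by blast
        then have "{n. x \<in> K n} \<subseteq> {n}" using uniq by blast
        then show ?thesis using finite_subset by blast
      qed simp
      then show "summable (\<lambda>n. norm (indicator (K n) x *\<^sub>R g n x))"
        by (rule summable_finite) auto
    qed
    show "summable (\<lambda>n. LINT x|M. norm (indicator (K n) x *\<^sub>R g n x))"
      using g(2) by (simp add: set_lebesgue_integral_def abs_mult)
  qed
  moreover have "integrable M (\<lambda>x. indicator (space M - (\<Union>n. K n)) x *\<^sub>R \<phi> x)"
    using K \<phi> by (intro integrable_mult_indicator) auto
  ultimately have "integrable M \<psi>" unfolding \<psi>_def by (rule Bochner_Integration.integrable_add)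
  moreover have "\<psi> x = g n x" if "x \<in> K n" for n x
    using that sums_unique[OF sums_single[of n "\<lambda>_. g n x"]] unfolding \<psi>_def at[OF that]
    by (auto simp: indicator_def)
  moreover have "\<psi> x = \<phi> x" if "x \<in> space M" "x \<notin> (\<Union>n. K n)" for x
    using that off[OF that(2)] by (auto simp: \<psi>_def indicator_def)
  ultimately show ?thesis using that by blast
qed

section \<open>Replacing a function on stopping intervals\<close>

lemma stopped_avg:
  assumes K: "\<And>n::nat. K n \<in> sets lebesgue" "disjoint_family K"
    and int: "integrable lebesgue \<phi>" "integrable lebesgue \<psi>"
    and off: "\<And>x. x \<notin> (\<Union>n. K n) \<Longrightarrow> \<psi> x = \<phi> x"
    and eq: "\<And>n. avg \<psi> (K n) = avg \<phi> (K n)"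
    and fin: "\<And>n. measure lebesgue (K n) \<noteq> 0 \<or> K n = {}"
    and H: "H \<in> sets lebesgue" "\<And>n. K n \<subseteq> H \<or> K n \<inter> H = {}"
  shows "avg \<psi> H = avg \<phi> H"
proof -
  \<comment> \<open>Equal averages give equal integrals only if no division by zero occurs; this is
    what \<open>fin\<close> ensures.\<close>
  have eq': "(LINT x:K n|lebesgue. \<psi> x) = (LINT x:K n|lebesgue. \<phi> x)" for n
    using eq[of n] fin[of n] by (auto simp: avg_def set_lebesgue_integral_def)
  have si: "set_integrable lebesgue A \<phi>" "set_integrable lebesgue A \<psi>" if "A \<in> sets lebesgue" for A
    using that int by (auto intro: integrable_imp_set_integrable)
  \<comment> \<open>The factors \<open>c = 1\<close> and \<open>c = -1\<close> yield the two
    inequalities of the equality.\<close>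
  have le: "(LINT x|lebesgue. indicator H x *\<^sub>R (c * (\<psi> x - \<phi> x))) \<le> 0" for c :: real
  proof (rule integral_nonpos_of_pieces[OF _ K])
    show "integrable lebesgue (\<lambda>x. indicator H x *\<^sub>R (c * (\<psi> x - \<phi> x)))"
      using H int by (intro integrable_mult_indicator) auto
    show "(LINT x:K n|lebesgue. indicator H x *\<^sub>R (c * (\<psi> x - \<phi> x))) \<le> 0" for n
    proof (cases "K n \<subseteq> H")
      case True
      then have "(LINT x:K n|lebesgue. indicator H x *\<^sub>R (c * (\<psi> x - \<phi> x))) = (LINT x:K n|lebesgue. c * (\<psi> x - \<phi> x))"
        using K by (intro set_lebesgue_integral_cong) auto
      also have "\<dots> = 0" using si[OF K(1)] eq'[of n] by (simp add: set_integral_diff)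
      finally show ?thesis by simp
    next
      case False
      then have "(LINT x:K n|lebesgue. indicator H x *\<^sub>R (c * (\<psi> x - \<phi> x))) = (LINT x:K n|lebesgue. 0)"
        using K H(2)[of n] by (intro set_lebesgue_integral_cong) (auto simp: indicator_def)
      then show ?thesis by simp
    qed
    show "AE x in lebesgue. x \<notin> (\<Union>n. K n) \<longrightarrow> indicator H x *\<^sub>R (c * (\<psi> x - \<phi> x)) \<le> 0"
      using off by auto
  qed
  have "(LINT x:H|lebesgue. c * (\<psi> x - \<phi> x)) = c * ((LINT x:H|lebesgue. \<psi> x) - (LINT x:H|lebesgue. \<phi> x))" for c
    using si[OF H(1)] by (simp add: set_integral_diff)
  then have "c * ((LINT x:H|lebesgue. \<psi> x) - (LINT x:H|lebesgue. \<phi> x)) \<le> 0" for c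
    using le[of c] unfolding set_lebesgue_integral_def by simp
  from this[of 1] this[of "-1"] show ?thesis by (simp add: avg_def)
qed

text \<open>An interval not contained in a piece has halves that cut no piece: by nestedness each
  piece lies in one half or is disjoint from it. The averages over both halves are then
  unchanged.\<close>

lemma stopped_half_diff:
  assumes J: "ivl J" and K: "\<And>n::nat. K n = {} \<or> K n \<in> subs J" "disjoint_family K"
    and int: "integrable lebesgue \<phi>" "integrable lebesgue \<psi>"
    and off: "\<And>x. x \<notin> (\<Union>n. K n) \<Longrightarrow> \<psi> x = \<phi> x"
    and eq: "\<And>n. K n \<noteq> {} \<Longrightarrow> avg \<psi> (K n) = avg \<phi> (K n)"
    and I: "I \<in> subs J" "\<And>n. \<not> I \<subseteq> K n"
  shows "half_diff \<psi> I = half_diff \<phi> I"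
proof -
  have ivlK: "K n = {} \<or> ivl (K n)" for n using K J subs_ivl by blast
  have ivlI: "ivl I" using I J subs_ivl by blast
  have ne: "left_half I \<noteq> {}" "right_half I \<noteq> {}" using ivlI ivl_nonempty by auto
  have avg: "avg \<psi> H = avg \<phi> H" if H: "H \<in> sets lebesgue" "\<And>n. K n \<subseteq> H \<or> K n \<inter> H = {}" for H
  proof (rule stopped_avg[OF _ K(2) int off _ _ H])
    show "K n \<in> sets lebesgue" for n using ivlK[of n] by auto
    show "avg \<psi> (K n) = avg \<phi> (K n)" for n using eq[of n] by (cases "K n = {}") (auto simp: avg_def)
    show "measure lebesgue (K n) \<noteq> 0 \<or> K n = {}" for n using ivlK[of n] ivl_measure_pos by fastforce
  qed auto
  \<comment> \<open>The delicate case is a half contained in the piece \<open>A\<close>. As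
    \<open>A\<close> does not contain the whole interval, it must coincide with that half.\<close>
  have nest: "(A \<subseteq> L \<or> A \<inter> L = {}) \<and> (A \<subseteq> R \<or> A \<inter> R = {})"
    if "A \<subseteq> L \<or> L \<subseteq> A \<or> A \<inter> L = {}" "A \<subseteq> R \<or> R \<subseteq> A \<or> A \<inter> R = {}"
      "A \<subseteq> L \<union> R \<or> A \<inter> (L \<union> R) = {}" "\<not> L \<union> R \<subseteq> A" "L \<inter> R = {}" for A L R :: "real set"
  proof -
    consider "L \<subseteq> A" | "R \<subseteq> A" | "\<not> L \<subseteq> A" "\<not> R \<subseteq> A" by blast
    then show ?thesis
    proof cases
      case 1
      then have "R \<inter> A = {} \<or> A \<subseteq> R" using that by blast
      then show ?thesis using 1 that by blast
    next
      case 2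
      then have "L \<inter> A = {} \<or> A \<subseteq> L" using that by blast
      then show ?thesis using 2 that by blast
    next
      case 3
      then show ?thesis using that by blast
    qed
  qed
  have "(K n \<subseteq> left_half I \<or> K n \<inter> left_half I = {}) \<and> (K n \<subseteq> right_half I \<or> K n \<inter> right_half I = {})" for n
  proof (cases "K n = {}")
    case False
    then have k: "K n \<in> subs J" using K by blast
    show ?thesis
    proof (rule nest)
      show "K n \<subseteq> left_half I \<or> left_half I \<subseteq> K n \<or> K n \<inter> left_half I = {}"
        "K n \<subseteq> right_half I \<or> right_half I \<subseteq> K n \<or> K n \<inter> right_half I = {}"
        using subs_nested[OF k] subs_half[OF I(1)] by blast+
      show "K n \<subseteq> left_half I \<union> right_half I \<or> K n \<inter> (left_half I \<union> right_half I) = {}"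
        unfolding half_Un[OF ivlI] using subs_nested[OF k I(1)] I(2)[of n] by blast
    qed (use I(2)[of n] half_Un[OF ivlI] half_Int[of I] in auto)
  qed simp
  then have "avg \<psi> (left_half I) = avg \<phi> (left_half I)" "avg \<psi> (right_half I) = avg \<phi> (right_half I)"
    using ivlI by (auto intro!: avg)
  then show ?thesis by (simp add: half_diff_def)
qed

section \<open>Raising the level and mixing two functions\<close>

lemma half_empty [simp]: "left_half {} = {}" "right_half {} = {}"
  by (simp_all add: left_half_def right_half_def)

lemma set_integral_eq_avg: "ivl I \<Longrightarrow> (LINT x:I|lebesgue. f x) = avg f I * measure lebesgue I"
  using ivl_measure_pos[of I] by (simp add: avg_def)

lemma avg_mono:
  assumes "integrable lebesgue f" "integrable lebesgue g" "ivl I" "\<And>x. x \<in> I \<Longrightarrow> f x \<le> g x"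
  shows "avg f I \<le> avg g I"
  unfolding avg_def using assms
  by (intro divide_right_mono set_integral_mono integrable_imp_set_integrable) auto

text \<open>On the maximal intervals \<open>K n\<close> of an open cover of \<open>{x \<in> J. sq_sup \<phi> J x < l}\<close>, \<open>\<phi>\<close> is
  replaced by its mean plus or minus \<open>sqrt l\<close>.\<close>

lemma raise_level:
  assumes J: "ivl J" and \<phi>: "integrable lebesgue \<phi>" and l: "0 < l" and e: "0 < e"
  obtains \<psi> where "integrable lebesgue \<psi>" "avg \<psi> J = avg \<phi> J" "level_set \<psi> J l = J"
    "avg (\<lambda>x. \<bar>\<psi> x\<bar>) J \<le> avg (\<lambda>x. \<bar>\<phi> x\<bar>) J
      + sqrt l * (1 - measure lebesgue (level_set \<phi> J l) / measure lebesgue J + e)"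
proof -
  define B where "B = J - level_set \<phi> J l"
  have mJ: "0 < measure lebesgue J" using ivl_measure_pos[OF J] .
  have Jl: "J \<in> lmeasurable" using J by (rule ivl_lmeasurable)
  have B: "B \<in> sets lebesgue" "B \<subseteq> J" using J by (auto simp: B_def)
  \<comment> \<open>Stopping families exist for open sets only; the excess of \<open>T\<close> over
    \<open>B\<close> is the source of \<open>e\<close> in the cost.\<close>
  obtain T where T: "open T" "B \<subseteq> T" "T - B \<in> lmeasurable"
    "emeasure lebesgue (T - B) < ennreal (e * measure lebesgue J)"
    using sets_lebesgue_outer_open[OF B(1), of "e * measure lebesgue J"] mJ e by auto
  have TB: "measure lebesgue (T - B) \<le> e * measure lebesgue J"
    using T(3,4) mJ e by (simp add: emeasure_eq_measure2 ennreal_less_iff less_imp_le del: emeasure_completion)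
  obtain K :: "nat \<Rightarrow> real set" where K: "disjoint_family K"
    "\<And>n. K n = {} \<or> K n \<in> subs J" "(\<Union>n. K n) = T \<inter> J"
    using stopping_family[OF J T(1)] by blast
  have ivlK: "K n = {} \<or> ivl (K n)" for n using K(2) J subs_ivl by blast
  have Ks: "K n \<in> sets lebesgue" for n using ivlK[of n] by auto
  have KJ: "K n \<subseteq> J" for n using K(2)[of n] subs_subset by blast
  define g where "g n x = avg \<phi> (K n) * indicator (K n) x
      + sqrt l * (indicator (right_half (K n)) x - indicator (left_half (K n)) x)" for n x
  have indK: "integrable lebesgue (indicator A :: real \<Rightarrow> real)" if "A = {} \<or> ivl A" for A
    using that ivl_lmeasurable[of A] by (auto simp: fmeasurable_def)
  have g_int: "integrable lebesgue (g n)" for n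
  proof -
    have "left_half (K n) = {} \<or> ivl (left_half (K n))" "right_half (K n) = {} \<or> ivl (right_half (K n))"
      using ivlK[of n] by auto
    then show ?thesis unfolding g_def using indK ivlK[of n]
      by (intro Bochner_Integration.integrable_add Bochner_Integration.integrable_diff integrable_mult_right) auto
  qed
  \<comment> \<open>A dominating function for the pieces: the absolute value of a mean is at most
    the mean of the absolute value, and the step adds at most \<open>sqrt l\<close>. It controls
    summability as well as the final cost.\<close>
  define h where "h x = indicator J x *\<^sub>R (\<bar>\<phi> x\<bar> + sqrt l * indicator J x)" for x
  have h_int: "integrable lebesgue h"
    unfolding h_def using J \<phi> indK by (intro integrable_mult_indicator Bochner_Integration.integrable_add) auto
  have h_nonneg: "0 \<le> h x" for x using l by (simp add: h_def)
  have gK: "(LINT x:K n|lebesgue. \<bar>g n x\<bar>) \<le> (LINT x:K n|lebesgue. h x)" for n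
  proof (cases "K n = {}")
    case True
    then show ?thesis by (simp add: set_lebesgue_integral_def)
  next
    case False
    then have iv: "ivl (K n)" using ivlK[of n] by blast
    have "avg (\<lambda>x. \<bar>g n x\<bar>) (K n) \<le> avg (\<lambda>x. \<bar>avg \<phi> (K n)\<bar> * indicator (K n) x + sqrt l * indicator (K n) x) (K n)"
    proof (rule avg_mono[OF _ _ iv])
      show "integrable lebesgue (\<lambda>x. \<bar>avg \<phi> (K n)\<bar> * indicator (K n) x + sqrt l * indicator (K n) x)"
        using indK[of "K n"] iv by (intro Bochner_Integration.integrable_add integrable_mult_right) auto
      show "\<bar>g n x\<bar> \<le> \<bar>avg \<phi> (K n)\<bar> * indicator (K n) x + sqrt l * indicator (K n) x" if "x \<in> K n" for x
        using that l abs_triangle_ineq[of "avg \<phi> (K n)" "sqrt l"] abs_triangle_ineq4[of "avg \<phi> (K n)" "sqrt l"]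
        by (auto simp: g_def indicator_def)
    qed (use g_int in auto)
    also have "\<dots> = avg (\<lambda>x. \<bar>avg \<phi> (K n)\<bar> + sqrt l) (K n)"
      using Ks by (intro avg_cong) auto
    also have "\<dots> \<le> avg (\<lambda>x. \<bar>\<phi> x\<bar>) (K n) + sqrt l"
      using abs_avg_le[of \<phi> "K n"] by (simp add: avg_const[OF iv])
    also have "\<dots> = avg (\<lambda>x. \<bar>\<phi> x\<bar> + sqrt l * indicator J x) (K n)"
    proof -
      have "avg (\<lambda>x. sqrt l * indicator J x) (K n) = avg (\<lambda>x. sqrt l) (K n)"
        using KJ[of n] Ks by (intro avg_cong) auto
      then show ?thesis using \<phi> indK J iv by (subst avg_add) (auto simp: avg_const[OF iv])
    qed
    also have "\<dots> = avg h (K n)"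
      using KJ[of n] Ks by (intro avg_cong) (auto simp: h_def)
    finally show ?thesis using ivl_measure_pos[OF iv] by (simp add: set_integral_eq_avg[OF iv])
  qed
  have sum: "summable (\<lambda>n. LINT x:K n|lebesgue. \<bar>g n x\<bar>)"
  proof (rule summable_comparison_test')
    show "summable (\<lambda>n. LINT x:K n|lebesgue. \<bar>h x\<bar>)"
      using summable_set_integral[OF h_int Ks K(1)] .
    show "norm (LINT x:K n|lebesgue. \<bar>g n x\<bar>) \<le> (LINT x:K n|lebesgue. \<bar>h x\<bar>)" for n
      using gK[of n] h_nonneg by (simp add: set_lebesgue_integral_def)
  qed
  obtain \<psi> where \<psi>: "integrable lebesgue \<psi>" "\<And>n x. x \<in> K n \<Longrightarrow> \<psi> x = g n x"
    "\<And>x. x \<notin> (\<Union>n. K n) \<Longrightarrow> \<psi> x = \<phi> x"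
    using glue_pieces[OF Ks K(1) g_int sum \<phi>] by auto
  have half: "avg \<psi> (left_half (K n)) = avg \<phi> (K n) - sqrt l \<and> avg \<psi> (right_half (K n)) = avg \<phi> (K n) + sqrt l"
    if iv: "ivl (K n)" for n
  proof -
    have il: "ivl (left_half (K n))" "ivl (right_half (K n))" using iv by auto
    have "\<psi> x = avg \<phi> (K n) - sqrt l" if x: "x \<in> left_half (K n)" for x
    proof -
      have "x \<in> K n" "x \<notin> right_half (K n)" using x half_subset half_Int by blast+
      then show ?thesis using x by (simp add: \<psi>(2)[of x n] g_def)
    qed
    then have "avg \<psi> (left_half (K n)) = avg (\<lambda>x. avg \<phi> (K n) - sqrt l) (left_half (K n))"
      using il by (intro avg_cong) auto
    moreover have "\<psi> x = avg \<phi> (K n) + sqrt l" if x: "x \<in> right_half (K n)" for x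
    proof -
      have "x \<in> K n" "x \<notin> left_half (K n)" using x half_subset half_Int by blast+
      then show ?thesis using x by (simp add: \<psi>(2)[of x n] g_def)
    qed
    then have "avg \<psi> (right_half (K n)) = avg (\<lambda>x. avg \<phi> (K n) + sqrt l) (right_half (K n))"
      using il by (intro avg_cong) auto
    ultimately show ?thesis using il by (simp add: avg_const)
  qed
  have avgK: "avg \<psi> (K n) = avg \<phi> (K n)" if "ivl (K n)" for n
    using half[OF that] by (simp add: avg_half[OF that \<psi>(1)])
  have avgJ: "avg \<psi> J = avg \<phi> J"
  proof (rule stopped_avg[OF Ks K(1) \<phi> \<psi>(1) \<psi>(3)])
    show "avg \<psi> (K n) = avg \<phi> (K n)" for n using avgK[of n] ivlK[of n] by (auto simp: avg_def set_lebesgue_integral_def)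
    show "measure lebesgue (K n) \<noteq> 0 \<or> K n = {}" for n using ivlK[of n] ivl_measure_pos by fastforce
    show "J \<in> sets lebesgue" using J by simp
    show "K n \<subseteq> J \<or> K n \<inter> J = {}" for n using KJ by blast
  qed auto
  have "level_set \<psi> J l = J"
  proof
    show "J \<subseteq> level_set \<psi> J l"
    proof
      fix x assume x: "x \<in> J"
      show "x \<in> level_set \<psi> J l"
      proof (cases "x \<in> (\<Union>n. K n)")
        case True
        then obtain n where n: "x \<in> K n" by blast
        then have iv: "ivl (K n)" and sub: "K n \<in> subs J" using ivlK[of n] K(2)[of n] by auto
        \<comment> \<open>This single term already brings the square function up to \<open>l\<close>
          on all of \<open>K n\<close>.\<close>
        have "half_diff \<psi> (K n) = sqrt l" using half[OF iv] by (simp add: half_diff_def)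
        then have "l \<le> sq_upto 1 \<psi> (K n) x" using n l by simp
        then have "ennreal l \<le> sq_sup \<psi> (K n) x"
          unfolding sq_sup_def by (intro SUP_upper2[of 1] ennreal_leI) auto
        also have "\<dots> \<le> sq_sup \<psi> J x" using J sub by (rule sq_sup_sub_le)
        finally show ?thesis using x by (simp add: level_set_def)
      next
        case False
        \<comment> \<open>No interval containing \<open>x\<close> lies in a piece, so every half
          difference seen at \<open>x\<close> is the old one; and \<open>x\<close> is outside
          \<open>B\<close>, where the old level was already sufficient.\<close>
        have "sq_sup \<psi> J x = sq_sup \<phi> J x"
        proof (rule sq_sup_eqI[OF J])
          fix I assume I: "I \<in> subs J" "x \<in> I"
          show "half_diff \<psi> I = half_diff \<phi> I"
            using I False ivlK by (intro stopped_half_diff[OF J K(2,1) \<phi> \<psi>(1) \<psi>(3) _ I(1)]) (auto intro: avgK)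
        qed
        moreover have "x \<in> level_set \<phi> J l" using False x T(2) K(3) by (auto simp: B_def)
        ultimately show ?thesis by (simp add: level_set_def)
      qed
    qed
  qed (rule level_set_subset)
  moreover have "avg (\<lambda>x. \<bar>\<psi> x\<bar>) J \<le> avg (\<lambda>x. \<bar>\<phi> x\<bar>) J
      + sqrt l * (1 - measure lebesgue (level_set \<phi> J l) / measure lebesgue J + e)"
  proof -
    \<comment> \<open>The excess of the new absolute value over the allowed cost. It has nonpositive
      integral on each piece and vanishes elsewhere.\<close>
    define k where "k x = indicator J x *\<^sub>R \<bar>\<psi> x\<bar> - indicator J x *\<^sub>R \<bar>\<phi> x\<bar> - sqrt l * indicator (T \<inter> J) x" for x
    have TJ: "T \<inter> J \<in> lmeasurable" using T(1) Jl by (subst inf_commute) (intro fmeasurable_Int_fmeasurable, auto)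
    have i1: "integrable lebesgue (\<lambda>x. indicator J x *\<^sub>R \<bar>\<psi> x\<bar>)" "integrable lebesgue (\<lambda>x. indicator J x *\<^sub>R \<bar>\<phi> x\<bar>)"
      using integrable_mult_indicator[OF ivl_sets[OF J] integrable_abs] \<phi> \<psi>(1) by blast+
    have i2: "integrable lebesgue (\<lambda>x. sqrt l * indicator (T \<inter> J) x :: real)"
      using TJ by (intro integrable_mult_right) (auto simp: fmeasurable_def)
    have k_int: "integrable lebesgue k" unfolding k_def using i1 i2 by (intro Bochner_Integration.integrable_diff)
    have "(LINT x|lebesgue. k x) \<le> 0"
    proof (rule integral_nonpos_of_pieces[OF k_int Ks K(1)])
      show "(LINT x:K n|lebesgue. k x) \<le> 0" for n
      proof -
        have "(LINT x:K n|lebesgue. k x) = (LINT x:K n|lebesgue. \<bar>g n x\<bar> - h x)"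
        proof (intro set_lebesgue_integral_cong allI impI)
          fix x assume x: "x \<in> K n"
          then have "x \<in> T \<inter> J" using K(3) by blast
          then show "k x = \<bar>g n x\<bar> - h x" by (simp add: k_def h_def \<psi>(2)[OF x])
        qed (rule Ks)
        also have "\<dots> = (LINT x:K n|lebesgue. \<bar>g n x\<bar>) - (LINT x:K n|lebesgue. h x)"
          using Ks g_int h_int by (intro set_integral_diff integrable_imp_set_integrable) auto
        finally show ?thesis using gK[of n] by simp
      qed
      show "AE x in lebesgue. x \<notin> (\<Union>n. K n) \<longrightarrow> k x \<le> 0"
        using K(3) \<psi>(3) by (intro AE_I2) (auto simp: k_def)
    qed
    also have "(LINT x|lebesgue. k x) = (LINT x:J|lebesgue. \<bar>\<psi> x\<bar>) - (LINT x:J|lebesgue. \<bar>\<phi> x\<bar>) - sqrt l * measure lebesgue (T \<inter> J)"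
      unfolding k_def set_lebesgue_integral_def using i1 i2
      by (subst Bochner_Integration.integral_diff; simp add: Bochner_Integration.integral_diff)+
    finally have a: "(LINT x:J|lebesgue. \<bar>\<psi> x\<bar>) \<le> (LINT x:J|lebesgue. \<bar>\<phi> x\<bar>) + sqrt l * measure lebesgue (T \<inter> J)" by simp
    have "T \<inter> J \<subseteq> B \<union> (T - B)" by blast
    moreover have Bl: "B \<in> lmeasurable" using fmeasurableI2[OF Jl B(2,1)] .
    ultimately have "measure lebesgue (T \<inter> J) \<le> measure lebesgue (B \<union> (T - B))"
      using TJ T(3) by (intro measure_mono_fmeasurable fmeasurable.Un fmeasurableD)
    also have "\<dots> \<le> measure lebesgue B + measure lebesgue (T - B)"
      using Bl T(3) by (intro measure_Un_le) auto
    also have "measure lebesgue B = measure lebesgue J - measure lebesgue (level_set \<phi> J l)"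
      unfolding B_def using Jl fmeasurableI2[OF Jl level_set_subset level_set_sets[OF J]] level_set_subset
      by (intro measurable_measure_Diff) auto
    finally have "measure lebesgue (T \<inter> J) \<le> measure lebesgue J - measure lebesgue (level_set \<phi> J l) + e * measure lebesgue J"
      using TB by simp
    then have "sqrt l * measure lebesgue (T \<inter> J) \<le> sqrt l * (measure lebesgue J - measure lebesgue (level_set \<phi> J l) + e * measure lebesgue J)"
      using l by (intro mult_left_mono) auto
    with a have "(LINT x:J|lebesgue. \<bar>\<psi> x\<bar>) \<le> (LINT x:J|lebesgue. \<bar>\<phi> x\<bar>) + sqrt l * (measure lebesgue J - measure lebesgue (level_set \<phi> J l) + e * measure lebesgue J)"
      by linarith
    then have "(LINT x:J|lebesgue. \<bar>\<psi> x\<bar>) / measure lebesgue J \<le>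
      ((LINT x:J|lebesgue. \<bar>\<phi> x\<bar>) + sqrt l * (measure lebesgue J - measure lebesgue (level_set \<phi> J l) + e * measure lebesgue J)) / measure lebesgue J"
      using mJ by (intro divide_right_mono) auto
    also have "\<dots> = avg (\<lambda>x. \<bar>\<phi> x\<bar>) J + sqrt l * (1 - measure lebesgue (level_set \<phi> J l) / measure lebesgue J + e)"
      using mJ by (simp add: avg_def field_simps)
    finally show ?thesis by (simp add: avg_def)
  qed
  ultimately show ?thesis using that \<psi>(1) avgJ by blast
qed

text \<open>Copies of \<open>\<phi>1\<close> are placed on the maximal intervals of \<open>J\<close> lying to the left of the point that
  divides \<open>J\<close> in the ratio \<open>\<theta> : 1 - \<theta>\<close>, and copies of \<open>\<phi>2\<close> on those lying to its right.\<close>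

lemma mixture:
  assumes J: "ivl J" and \<phi>: "integrable lebesgue \<phi>1" "integrable lebesgue \<phi>2"
    and \<theta>: "0 \<le> \<theta>" "\<theta> \<le> 1"
  obtains \<psi> where "integrable lebesgue \<psi>"
    "avg \<psi> J = \<theta> * avg \<phi>1 J + (1 - \<theta>) * avg \<phi>2 J"
    "avg (\<lambda>x. \<bar>\<psi> x\<bar>) J = \<theta> * avg (\<lambda>x. \<bar>\<phi>1 x\<bar>) J + (1 - \<theta>) * avg (\<lambda>x. \<bar>\<phi>2 x\<bar>) J"
    "\<theta> * (measure lebesgue (level_set \<phi>1 J l) / measure lebesgue J)
      + (1 - \<theta>) * (measure lebesgue (level_set \<phi>2 J l) / measure lebesgue J)
      \<le> measure lebesgue (level_set \<psi> J l) / measure lebesgue J"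
    "0 < l \<Longrightarrow> avg \<phi>1 J = avg \<phi>2 J \<Longrightarrow>
      measure lebesgue (level_set \<psi> J l) / measure lebesgue J =
      \<theta> * (measure lebesgue (level_set \<phi>1 J l) / measure lebesgue J)
      + (1 - \<theta>) * (measure lebesgue (level_set \<phi>2 J l) / measure lebesgue J)"
proof -
  obtain a b where ab: "a < b" "J = {a..<b}" using J by (auto simp: ivl_def)
  define c where "c = a + \<theta> * (b - a)"
  have c: "a \<le> c" "c \<le> b" "c - a = \<theta> * (b - a)" "b - c = (1 - \<theta>) * (b - a)"
    using ab \<theta> mult_right_mono[of \<theta> 1 "b - a"] mult_left_mono[of a b \<theta>] by (auto simp: c_def algebra_simps)
  define ratio where "ratio \<phi> I = measure lebesgue (level_set \<phi> I l) / measure lebesgue I" for \<phi> I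
  obtain K :: "nat \<Rightarrow> real set" where K: "disjoint_family K"
    "\<And>n. K n = {} \<or> K n \<in> subs J" "(\<Union>n. K n) = (- {c}) \<inter> J"
    using stopping_family[OF J, of "- {c}"] by auto
  have ivlK: "K n = {} \<or> ivl (K n)" for n using K(2) J subs_ivl by blast
  have Ks: "K n \<in> sets lebesgue" for n using ivlK[of n] by auto
  have KJ: "K n \<subseteq> J" for n using K(2)[of n] subs_subset by blast
  have cK: "c \<notin> K n" for n using K(3) by blast
  define lab where "lab n \<longleftrightarrow> K n \<subseteq> {..<c}" for n
  have labK: "(lab n \<longrightarrow> K n \<subseteq> {a..<c}) \<and> (\<not> lab n \<longrightarrow> K n \<subseteq> {c..<b})" for n
  proof (cases "K n = {}")
    case False
    then obtain u v where uv: "u < v" "K n = {u..<v}" using ivlK[of n] by (auto simp: ivl_def)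
    have "v \<le> c \<or> c < u" using cK[of n] uv by auto
    then show ?thesis using KJ[of n] uv ab by (auto simp: lab_def)
  qed (simp add: lab_def)
  define src where "src n = (if lab n then \<phi>1 else \<phi>2)" for n
  have src: "integrable lebesgue (src n)" for n using \<phi> by (simp add: src_def)
  have "\<exists>g. integrable lebesgue g \<and> (ivl (K n) \<longrightarrow> avg g (K n) = avg (src n) J
      \<and> avg (\<lambda>x. \<bar>g x\<bar>) (K n) = avg (\<lambda>x. \<bar>src n x\<bar>) J \<and> ratio g (K n) = ratio (src n) J)" for n
  proof (cases "ivl (K n)")
    case True
    obtain g where "integrable lebesgue g" "avg g (K n) = avg (src n) J"
      "avg (\<lambda>x. \<bar>g x\<bar>) (K n) = avg (\<lambda>x. \<bar>src n x\<bar>) J" "ratio g (K n) = ratio (src n) J"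
      unfolding ratio_def using affine_copy[OF J True src, of n l] by metis
    then show ?thesis by blast
  qed (use src in blast)
  then obtain g where g: "\<And>n. integrable lebesgue (g n)" "\<And>n. ivl (K n) \<Longrightarrow> avg (g n) (K n) = avg (src n) J"
    "\<And>n. ivl (K n) \<Longrightarrow> avg (\<lambda>x. \<bar>g n x\<bar>) (K n) = avg (\<lambda>x. \<bar>src n x\<bar>) J"
    "\<And>n. ivl (K n) \<Longrightarrow> ratio (g n) (K n) = ratio (src n) J"
    by metis
  have indJ: "integrable lebesgue (indicator J :: real \<Rightarrow> real)"
    using ivl_lmeasurable[OF J] by (auto simp: fmeasurable_def)
  have sum: "summable (\<lambda>n. LINT x:K n|lebesgue. \<bar>g n x\<bar>)"
  proof (rule summable_comparison_test')
    define C where "C = avg (\<lambda>x. \<bar>\<phi>1 x\<bar>) J + avg (\<lambda>x. \<bar>\<phi>2 x\<bar>) J"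
    have pos: "0 \<le> avg (\<lambda>x. \<bar>\<phi>1 x\<bar>) J" "0 \<le> avg (\<lambda>x. \<bar>\<phi>2 x\<bar>) J"
      using abs_avg_le[of \<phi>1 J] abs_avg_le[of \<phi>2 J] by auto
    show "summable (\<lambda>n. C * (LINT x:K n|lebesgue. \<bar>indicator J x\<bar>))"
      using summable_set_integral[OF indJ Ks K(1)] by (rule summable_mult)
    show "norm (LINT x:K n|lebesgue. \<bar>g n x\<bar>) \<le> C * (LINT x:K n|lebesgue. \<bar>indicator J x\<bar>)" for n
    proof (cases "K n = {}")
      case False
      then have iv: "ivl (K n)" using ivlK[of n] by blast
      have "avg (\<lambda>x. \<bar>g n x\<bar>) (K n) \<le> C" using g(3)[OF iv] pos by (auto simp: C_def src_def)
      moreover have "0 \<le> avg (\<lambda>x. \<bar>g n x\<bar>) (K n)" using abs_avg_le[of "g n" "K n"] by linarith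
      moreover have "avg (\<lambda>x. \<bar>indicator J x :: real\<bar>) (K n) = avg (\<lambda>x. 1) (K n)"
        using KJ[of n] Ks by (intro avg_cong) auto
      ultimately show ?thesis unfolding set_integral_eq_avg[OF iv]
        using iv by (simp add: avg_const abs_mult mult_right_mono)
    qed (simp add: set_lebesgue_integral_def)
  qed
  \<comment> \<open>The background matters in \<open>J\<close> only at the point \<open>c\<close>.
    Taking it constant on \<open>J\<close> makes its half differences vanish, which is later
    compared with those of \<open>\<psi>\<close> when the two means agree.\<close>
  have int0: "integrable lebesgue (\<lambda>x. avg \<phi>1 J * indicator J x)" using indJ by simp
  obtain \<psi> where \<psi>: "integrable lebesgue \<psi>" "\<And>n x. x \<in> K n \<Longrightarrow> \<psi> x = g n x"
    "\<And>x. x \<notin> (\<Union>n. K n) \<Longrightarrow> \<psi> x = avg \<phi>1 J * indicator J x"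
    using glue_pieces[OF Ks K(1) g(1) sum int0] by auto
  \<comment> \<open>The one-sided form serves the level of a mixture with different means: there
    coarse intervals may add to the square function, and only a lower bound survives.\<close>
  have mix_le: "avg h J \<le> \<theta> * c1 + (1 - \<theta>) * c2"
    if h: "integrable lebesgue h" "\<And>n. ivl (K n) \<Longrightarrow> avg h (K n) \<le> (if lab n then c1 else c2)" for h c1 c2
  proof -
    define k where "k x = indicator J x *\<^sub>R h x - (c1 * indicator {a..<c} x + c2 * indicator {c..<b} x)" for x
    have i: "integrable lebesgue (\<lambda>x. indicator J x *\<^sub>R h x)"
      "integrable lebesgue (\<lambda>x. c1 * indicator {a..<c} x)" "integrable lebesgue (\<lambda>x. c2 * indicator {c..<b} x)"
    proof -
      have "{u..<v} \<in> lmeasurable" for u v :: real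
        by (intro bounded_set_imp_lmeasurable bounded_subset[OF bounded_closed_interval[of u v]]) auto
      then have "integrable lebesgue (indicator {u..<v} :: real \<Rightarrow> real)" for u v
        using integrable_real_indicator[of "{u..<v}" lebesgue] unfolding fmeasurable_def by blast
      then show "integrable lebesgue (\<lambda>x. indicator J x *\<^sub>R h x)"
        "integrable lebesgue (\<lambda>x. c1 * indicator {a..<c} x)" "integrable lebesgue (\<lambda>x. c2 * indicator {c..<b} x)"
        using integrable_mult_indicator[OF ivl_sets[OF J] h(1)] by simp_all
    qed
    have k_int: "integrable lebesgue k"
      unfolding k_def using i by (intro Bochner_Integration.integrable_diff Bochner_Integration.integrable_add)
    have "(LINT x|lebesgue. k x) \<le> 0"
    proof (rule integral_nonpos_of_pieces[OF k_int Ks K(1)])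
      show "(LINT x:K n|lebesgue. k x) \<le> 0" for n
      proof (cases "K n = {}")
        case False
        then have iv: "ivl (K n)" using ivlK[of n] by blast
        have "(LINT x:K n|lebesgue. k x) = avg k (K n) * measure lebesgue (K n)" by (rule set_integral_eq_avg[OF iv])
        also have "avg k (K n) = avg (\<lambda>x. h x + - (if lab n then c1 else c2) * indicator J x) (K n)"
          using labK[of n] KJ[of n] Ks by (intro avg_cong) (auto simp: k_def indicator_def subset_iff)
        also have "\<dots> = avg h (K n) + avg (\<lambda>x. - (if lab n then c1 else c2) * indicator J x) (K n)"
          using h indJ iv by (intro avg_add integrable_mult_right) auto
        also have "avg (\<lambda>x. - (if lab n then c1 else c2) * indicator J x) (K n) = avg (\<lambda>x. - (if lab n then c1 else c2)) (K n)"
          using KJ[of n] Ks by (intro avg_cong) auto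
        finally show ?thesis using h(2)[OF iv] by (simp only: avg_const[OF iv]) (simp add: mult_nonpos_nonneg)
      qed (simp add: set_lebesgue_integral_def)
      \<comment> \<open>The point \<open>c\<close> is the only one in \<open>J\<close> left
        uncovered.\<close>
      have "AE x in lebesgue. x \<notin> {c}" by (intro AE_not_in) (simp add: null_sets_completionI)
      moreover have "k x \<le> 0" if x: "x \<notin> {c}" "x \<notin> (\<Union>n. K n)" for x
      proof -
        have "x \<notin> J" using x K(3) by blast
        moreover from this have "x \<notin> {a..<c}" "x \<notin> {c..<b}"
          using order_less_le_trans[OF _ c(2), of x] order_trans[OF c(1), of x] unfolding ab(2) by auto
        ultimately show ?thesis by (simp add: k_def del: atLeastLessThan_iff)
      qed
      ultimately show "AE x in lebesgue. x \<notin> (\<Union>n. K n) \<longrightarrow> k x \<le> 0"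
        by (auto elim!: eventually_mono)
    qed
    also have "(LINT x|lebesgue. k x) = (LINT x:J|lebesgue. h x) - (c1 * (c - a) + c2 * (b - c))"
      unfolding k_def set_lebesgue_integral_def using i c
      by (subst Bochner_Integration.integral_diff; simp add: Bochner_Integration.integral_add)+
    finally have "(LINT x:J|lebesgue. h x) \<le> (\<theta> * c1 + (1 - \<theta>) * c2) * (b - a)"
      unfolding c by (simp add: algebra_simps)
    moreover have "measure lebesgue J = b - a" using ab by simp
    ultimately show ?thesis using ab(1) by (simp add: avg_def divide_le_eq)
  qed
  have mix_eq: "avg h J = \<theta> * c1 + (1 - \<theta>) * c2"
    if h: "integrable lebesgue h" "\<And>n. ivl (K n) \<Longrightarrow> avg h (K n) = (if lab n then c1 else c2)" for h c1 c2
  proof -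
    have neg: "avg (\<lambda>x. - h x) I = - avg h I" for I using avg_mult[of "-1" h I] by simp
    have "avg (\<lambda>x. - h x) J \<le> \<theta> * (- c1) + (1 - \<theta>) * (- c2)"
      using h by (intro mix_le) (auto simp: neg)
    moreover have "avg h J \<le> \<theta> * c1 + (1 - \<theta>) * c2" using h by (intro mix_le) auto
    ultimately show ?thesis by (simp add: neg)
  qed
  have avgK: "avg \<psi> (K n) = avg (src n) J" if iv: "ivl (K n)" for n
    using g(2)[OF iv] \<psi>(2) avg_cong[OF Ks, of n \<psi> "g n"] by simp
  have avgK': "avg (\<lambda>x. \<bar>\<psi> x\<bar>) (K n) = avg (\<lambda>x. \<bar>src n x\<bar>) J" if iv: "ivl (K n)" for n
    using g(3)[OF iv] \<psi>(2) avg_cong[OF Ks, of n "\<lambda>x. \<bar>\<psi> x\<bar>" "\<lambda>x. \<bar>g n x\<bar>"] by simp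
  have ratioK: "ratio \<psi> (K n) = ratio (src n) J" if iv: "ivl (K n)" for n
  proof -
    have "level_set \<psi> (K n) l = level_set (g n) (K n) l"
      unfolding level_set_def using sq_sup_cong[OF iv \<psi>(2)] by simp
    then show ?thesis using g(4)[OF iv] by (simp add: ratio_def)
  qed
  define E where "E = level_set \<psi> J l"
  have E: "E \<in> sets lebesgue" "E \<subseteq> J" using J level_set_subset by (auto simp: E_def)
  have E_int: "integrable lebesgue (indicator E :: real \<Rightarrow> real)"
    using fmeasurableI2[OF ivl_lmeasurable[OF J] E(2,1)] by (auto simp: fmeasurable_def)
  have avgE: "avg (indicator E) J = ratio \<psi> J"
    using E ivl_lmeasurable[OF J] by (simp add: avg_indicator ratio_def E_def inf.absorb1)
  have subE: "level_set \<psi> (K n) l \<subseteq> E \<inter> K n" if "ivl (K n)" for n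
  proof -
    have "K n \<in> subs J" using that K(2)[of n] ivl_nonempty by blast
    then show ?thesis using sq_sup_sub_le[OF J, of "K n" \<psi>] KJ[of n]
      by (auto simp: E_def level_set_def intro: order_trans)
  qed
  have lo: "ratio (src n) J \<le> avg (indicator E) (K n)" if iv: "ivl (K n)" for n
  proof -
    have "E \<inter> K n \<in> lmeasurable"
      using fmeasurable_Int_fmeasurable[OF ivl_lmeasurable[OF iv] E(1)] by (simp add: inf_commute)
    then have "measure lebesgue (level_set \<psi> (K n) l) \<le> measure lebesgue (E \<inter> K n)"
      using subE[OF iv] iv by (intro measure_mono_fmeasurable) auto
    then have "ratio \<psi> (K n) \<le> avg (indicator E) (K n)"
      using E iv by (simp add: avg_indicator ivl_lmeasurable ratio_def divide_right_mono)
    then show ?thesis using ratioK[OF iv] by simp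
  qed
  have r1: "\<theta> * ratio \<phi>1 J + (1 - \<theta>) * ratio \<phi>2 J \<le> ratio \<psi> J"
  proof -
    have neg: "avg (\<lambda>x. - indicator E x) I = - avg (indicator E) I" for I
      using avg_mult[of "-1" "indicator E" I] by simp
    have "avg (\<lambda>x. - indicator E x) J \<le> \<theta> * (- ratio \<phi>1 J) + (1 - \<theta>) * (- ratio \<phi>2 J)"
    proof (rule mix_le)
      show "avg (\<lambda>x. - indicator E x) (K n) \<le> (if lab n then - ratio \<phi>1 J else - ratio \<phi>2 J)" if "ivl (K n)" for n
        using lo[OF that] by (simp add: neg src_def split: if_splits)
    qed (use E_int in simp)
    then show ?thesis by (simp add: neg avgE)
  qed
  have r2: "ratio \<psi> J = \<theta> * ratio \<phi>1 J + (1 - \<theta>) * ratio \<phi>2 J" if l: "0 < l" and eq: "avg \<phi>1 J = avg \<phi>2 J"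
  proof -
    have "avg (indicator E) (K n) = (if lab n then ratio \<phi>1 J else ratio \<phi>2 J)" if iv: "ivl (K n)" for n
    proof -
      have sub: "K n \<in> subs J" using iv K(2)[of n] ivl_nonempty by blast
      have "E \<inter> K n \<subseteq> level_set \<psi> (K n) l"
      proof
        fix x assume x: "x \<in> E \<inter> K n"
        \<comment> \<open>An interval containing \<open>x\<close> but not inside \<open>K n\<close>
          lies in no piece, by disjointness. With equal means \<open>\<psi>\<close> has the averages
          of a constant on all pieces, so its half difference there is zero.\<close>
        have "sq_sup \<psi> J x = sq_sup \<psi> (K n) x"
        proof (rule sq_sup_sub_eq[OF J sub])
          fix I assume I: "I \<in> subs J" "\<not> I \<subseteq> K n" "x \<in> I"
          have "\<not> I \<subseteq> K m" for m
          proof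
            assume "I \<subseteq> K m"
            then have "m = n" using I x K(1) by (auto simp: disjoint_family_on_def)
            then show False using I \<open>I \<subseteq> K m\<close> by simp
          qed
          have iI: "ivl I" using I J subs_ivl by blast
          have cst: "avg (\<lambda>x. avg \<phi>1 J * indicator J x) H = avg \<phi>1 J" if "ivl H" "H \<subseteq> J" for H
          proof -
            have "avg (\<lambda>x. avg \<phi>1 J * indicator J x) H = avg (\<lambda>x. avg \<phi>1 J) H"
              using that by (intro avg_cong) auto
            then show ?thesis using that by (simp add: avg_const)
          qed
          have "half_diff \<psi> I = half_diff (\<lambda>x. avg \<phi>1 J * indicator J x) I"
          proof (rule stopped_half_diff[OF J K(2,1) int0 \<psi>(1) \<psi>(3) _ I(1)])
            show "avg \<psi> (K m) = avg (\<lambda>x. avg \<phi>1 J * indicator J x) (K m)" if "K m \<noteq> {}" for m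
              using that ivlK[of m] KJ[of m] avgK[of m] cst[of "K m"] eq by (auto simp: src_def)
          qed (use \<open>\<And>m. \<not> I \<subseteq> K m\<close> in auto)
          also have "\<dots> = 0"
            using iI half_subset[of I] subs_subset[OF I(1)] by (simp add: half_diff_def cst subset_trans)
          finally show "half_diff \<psi> I = 0" .
        qed (use x in auto)
        then show "x \<in> level_set \<psi> (K n) l" using x by (auto simp: E_def level_set_def)
      qed
      then have "E \<inter> K n = level_set \<psi> (K n) l" using subE[OF iv] by blast
      then have "avg (indicator E) (K n) = ratio \<psi> (K n)"
        using E iv by (simp add: avg_indicator ivl_lmeasurable ratio_def)
      then show ?thesis using ratioK[OF iv] by (simp add: src_def)
    qed
    then have "avg (indicator E) J = \<theta> * ratio \<phi>1 J + (1 - \<theta>) * ratio \<phi>2 J"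
      using E_int by (intro mix_eq) auto
    then show ?thesis by (simp add: avgE)
  qed
  have m1: "avg \<psi> J = \<theta> * avg \<phi>1 J + (1 - \<theta>) * avg \<phi>2 J"
    using \<psi>(1) by (intro mix_eq) (auto simp: avgK src_def)
  have m2: "avg (\<lambda>x. \<bar>\<psi> x\<bar>) J = \<theta> * avg (\<lambda>x. \<bar>\<phi>1 x\<bar>) J + (1 - \<theta>) * avg (\<lambda>x. \<bar>\<phi>2 x\<bar>) J"
    using \<psi>(1) by (intro mix_eq) (auto simp: avgK' src_def)
  show ?thesis by (rule that[OF \<psi>(1) m1 m2 r1[unfolded ratio_def] r2[unfolded ratio_def]])
qed

section \<open>Attained triples\<close>

definition attained :: "real set \<Rightarrow> real \<Rightarrow> real \<Rightarrow> real \<Rightarrow> real \<Rightarrow> bool" where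
  "attained J l f p F \<longleftrightarrow> (\<exists>\<phi>. integrable_supported J \<phi> \<and> avg \<phi> J = f \<and>
     avg (\<lambda>x. \<bar>\<phi> x\<bar>) J = F \<and> level_frac J \<phi> l = p)"

text \<open>With \<open>bellman_L_eq\<close> this exhibits both functions as extrema over
  perpendicular sections of one set of pairs \<open>(p, F)\<close>.\<close>

lemma bellman_M_eq: "bellman_M J f F l = Sup {p. attained J l f p F}"
  unfolding bellman_M_def attained_def by (rule arg_cong[where f = Sup]) blast

lemma bellman_L_eq: "bellman_L J f p l = Inf {F. attained J l f p F}"
  unfolding bellman_L_def attained_def by (rule arg_cong[where f = Inf]) blast

text \<open>Cutting off outside \<open>J\<close> changes none of the three numbers, so the support
  condition can be ignored from here on.\<close>

lemma attainedI:
  assumes "J \<in> dyadic" "integrable lebesgue \<phi>"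
  shows "attained J l (avg \<phi> J) (measure lebesgue (level_set \<phi> J l) / measure lebesgue J) (avg (\<lambda>x. \<bar>\<phi> x\<bar>) J)"
proof -
  have J: "ivl J" using assms dyadic_imp_ivl by blast
  define \<psi> where "\<psi> x = indicator J x *\<^sub>R \<phi> x" for x
  have eq: "\<psi> x = \<phi> x" if "x \<in> J" for x using that by (simp add: \<psi>_def)
  have "integrable_supported J \<psi>"
    using integrable_mult_indicator[OF ivl_sets[OF J] assms(2)]
    by (simp add: integrable_supported_def \<psi>_def[abs_def])
  moreover have "avg \<psi> J = avg \<phi> J" "avg (\<lambda>x. \<bar>\<psi> x\<bar>) J = avg (\<lambda>x. \<bar>\<phi> x\<bar>) J"
    using J eq by (auto intro!: avg_cong)
  moreover have "level_set \<psi> J l = level_set \<phi> J l"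
    unfolding level_set_def using sq_sup_cong[OF J eq] by simp
  ultimately show ?thesis
    unfolding attained_def using level_frac_eq[OF assms(1), of \<psi> l] by metis
qed

lemma attainedE:
  assumes "J \<in> dyadic" "attained J l f p F"
  obtains \<phi> where "integrable lebesgue \<phi>" "avg \<phi> J = f" "avg (\<lambda>x. \<bar>\<phi> x\<bar>) J = F"
    "measure lebesgue (level_set \<phi> J l) / measure lebesgue J = p"
  using assms unfolding attained_def integrable_supported_def by (metis level_frac_eq)

lemma attained_bounds:
  assumes "J \<in> dyadic" "attained J l f p F"
  shows "0 \<le> p" "p \<le> 1" "\<bar>f\<bar> \<le> F"
proof -
  have J: "ivl J" using assms dyadic_imp_ivl by blast
  obtain \<phi> where \<phi>: "integrable lebesgue \<phi>" "avg \<phi> J = f" "avg (\<lambda>x. \<bar>\<phi> x\<bar>) J = F"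
    "measure lebesgue (level_set \<phi> J l) / measure lebesgue J = p"
    using attainedE[OF assms] by blast
  have "measure lebesgue (level_set \<phi> J l) \<le> measure lebesgue J"
    using J level_set_subset by (intro measure_mono_fmeasurable) (auto simp: ivl_lmeasurable)
  then show "p \<le> 1" using \<phi>(4) ivl_measure_pos[OF J] by (auto simp: divide_le_eq)
  show "0 \<le> p" using \<phi>(4) by auto
  show "\<bar>f\<bar> \<le> F" using \<phi> abs_avg_le by metis
qed

lemma attained_uminus:
  assumes "J \<in> dyadic" "attained J l f p F" shows "attained J l (- f) p F"
proof -
  obtain \<phi> where \<phi>: "integrable lebesgue \<phi>" "avg \<phi> J = f" "avg (\<lambda>x. \<bar>\<phi> x\<bar>) J = F"
    "measure lebesgue (level_set \<phi> J l) / measure lebesgue J = p"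
    using attainedE[OF assms] by blast
  have "level_set (\<lambda>x. - \<phi> x) J l = level_set \<phi> J l" by (simp add: level_set_def sq_sup_uminus)
  then show ?thesis
    using attainedI[OF assms(1), of "\<lambda>x. - \<phi> x" l] \<phi> avg_mult[of "-1" \<phi> J] by simp
qed

text \<open>The constant function: the cheap end of every mixture that lowers \<open>p\<close> or
  \<open>F\<close>.\<close>

lemma attained_const:
  assumes "J \<in> dyadic" "0 < l" shows "attained J l f 0 \<bar>f\<bar>"
proof -
  have J: "ivl J" using assms dyadic_imp_ivl by blast
  define \<phi> where "\<phi> x = f * indicator J x" for x :: real
  have \<phi>: "integrable lebesgue \<phi>" using ivl_lmeasurable[OF J]
    by (auto simp: \<phi>_def[abs_def] fmeasurable_def)
  have c: "avg \<phi> H = f" if "ivl H" "H \<subseteq> J" for H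
  proof -
    have "avg \<phi> H = avg (\<lambda>x. f) H" using that by (intro avg_cong) (auto simp: \<phi>_def)
    then show ?thesis using that by (simp add: avg_const)
  qed
  have "avg (\<lambda>x. \<bar>\<phi> x\<bar>) J = avg (\<lambda>x. \<bar>f\<bar>) J" using J by (intro avg_cong) (auto simp: \<phi>_def)
  then have a: "avg (\<lambda>x. \<bar>\<phi> x\<bar>) J = \<bar>f\<bar>" using J by (simp add: avg_const)
  \<comment> \<open>Comparison with a zero multiple shows through \<open>sq_sup_mult\<close> that
    the square function vanishes.\<close>
  have "sq_sup \<phi> J x = sq_sup (\<lambda>x. 0 * \<phi> x) J x" for x
  proof (rule sq_sup_eqI[OF J])
    fix I assume I: "I \<in> subs J"
    then have "ivl I" "I \<subseteq> J" using J subs_ivl subs_subset by auto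
    then have "half_diff \<phi> I = 0" using half_subset[of I] by (simp add: half_diff_def c subset_trans)
    then show "half_diff \<phi> I = half_diff (\<lambda>x. 0 * \<phi> x) I" by (simp only: half_diff_mult)
  qed
  then have "level_set \<phi> J l = {}" using assms unfolding sq_sup_mult by (auto simp: level_set_def)
  then show ?thesis using attainedI[OF assms(1) \<phi>, of l] a c[OF J] by simp
qed

text \<open>A single step with values \<open>f - h\<close> and \<open>f + h\<close>. Since
  \<open>|f| \<le> h\<close> the values have opposite signs or vanish, so the absolute mean is
  exactly \<open>h\<close>.\<close>

lemma attained_one:
  assumes "J \<in> dyadic" "0 < l" "sqrt l \<le> h" "\<bar>f\<bar> \<le> h" shows "attained J l f 1 h"
proof -
  have J: "ivl J" using assms dyadic_imp_ivl by blast
  have il: "ivl (left_half J)" "ivl (right_half J)" using J by auto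
  define \<phi> where "\<phi> x = (f - h) * indicator (left_half J) x + (f + h) * indicator (right_half J) x" for x
  have \<phi>: "integrable lebesgue \<phi>" using ivl_lmeasurable[OF il(1)] ivl_lmeasurable[OF il(2)]
    by (auto simp: \<phi>_def[abs_def] fmeasurable_def)
  have l: "\<phi> x = f - h" if "x \<in> left_half J" for x
    using that half_Int[of J] by (auto simp: \<phi>_def indicator_def)
  have r: "\<phi> x = f + h" if "x \<in> right_half J" for x
    using that half_Int[of J] by (auto simp: \<phi>_def indicator_def)
  have "avg \<phi> (left_half J) = avg (\<lambda>x. f - h) (left_half J)" "avg \<phi> (right_half J) = avg (\<lambda>x. f + h) (right_half J)"
    using il l r by (auto intro!: avg_cong)
  then have lr: "avg \<phi> (left_half J) = f - h" "avg \<phi> (right_half J) = f + h" using il by (simp_all add: avg_const)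
  then have f: "avg \<phi> J = f" by (simp add: avg_half[OF J \<phi>])
  have "avg (\<lambda>x. \<bar>\<phi> x\<bar>) (left_half J) = avg (\<lambda>x. h - f) (left_half J)"
    "avg (\<lambda>x. \<bar>\<phi> x\<bar>) (right_half J) = avg (\<lambda>x. f + h) (right_half J)"
    using il l r assms(4) by (auto intro!: avg_cong)
  then have h: "avg (\<lambda>x. \<bar>\<phi> x\<bar>) J = h"
    using il by (simp add: avg_half[OF J integrable_abs[OF \<phi>]] avg_const)
  have "level_set \<phi> J l = J"
  proof
    show "J \<subseteq> level_set \<phi> J l"
    proof
      fix x assume x: "x \<in> J"
      have "l = (sqrt l)\<^sup>2" using assms by simp
      also have "\<dots> \<le> h\<^sup>2" using assms by (intro power_mono) auto
      also have "\<dots> = sq_upto 1 \<phi> J x" using x lr by (simp add: half_diff_def)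
      finally have "ennreal l \<le> sq_sup \<phi> J x"
        unfolding sq_sup_def by (intro SUP_upper2[of 1] ennreal_leI) auto
      then show "x \<in> level_set \<phi> J l" using x by (simp add: level_set_def)
    qed
  qed (rule level_set_subset)
  then show ?thesis using attainedI[OF assms(1) \<phi>, of l] f h ivl_measure_pos[OF J] by simp
qed

lemma attained_convex:
  assumes "J \<in> dyadic" "0 < l" "attained J l f p F" "attained J l f q G" "0 \<le> \<theta>" "\<theta> \<le> 1"
  shows "attained J l f (\<theta> * p + (1 - \<theta>) * q) (\<theta> * F + (1 - \<theta>) * G)"
proof -
  have J: "ivl J" using assms dyadic_imp_ivl by blast
  obtain \<phi>1 where 1: "integrable lebesgue \<phi>1" "avg \<phi>1 J = f" "avg (\<lambda>x. \<bar>\<phi>1 x\<bar>) J = F"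
    "measure lebesgue (level_set \<phi>1 J l) / measure lebesgue J = p"
    using attainedE[OF assms(1,3)] by blast
  obtain \<phi>2 where 2: "integrable lebesgue \<phi>2" "avg \<phi>2 J = f" "avg (\<lambda>x. \<bar>\<phi>2 x\<bar>) J = G"
    "measure lebesgue (level_set \<phi>2 J l) / measure lebesgue J = q"
    using attainedE[OF assms(1,4)] by blast
  obtain \<psi> where "integrable lebesgue \<psi>" "avg \<psi> J = \<theta> * f + (1 - \<theta>) * f"
    "avg (\<lambda>x. \<bar>\<psi> x\<bar>) J = \<theta> * F + (1 - \<theta>) * G"
    "measure lebesgue (level_set \<psi> J l) / measure lebesgue J = \<theta> * p + (1 - \<theta>) * q"
    using mixture[OF J 1(1) 2(1) assms(5,6), of l] assms(2) 1 2 by metis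
  moreover have "\<theta> * f + (1 - \<theta>) * f = f" by (simp add: algebra_simps)
  ultimately show ?thesis using attainedI[OF assms(1), of \<psi> l] by simp
qed

lemma attained_raise:
  assumes "J \<in> dyadic" "0 < l" "attained J l f p F" "0 < e"
  obtains G where "attained J l f 1 G" "G \<le> F + sqrt l * (1 - p + e)"
proof -
  have J: "ivl J" using assms dyadic_imp_ivl by blast
  obtain \<phi> where \<phi>: "integrable lebesgue \<phi>" "avg \<phi> J = f" "avg (\<lambda>x. \<bar>\<phi> x\<bar>) J = F"
    "measure lebesgue (level_set \<phi> J l) / measure lebesgue J = p"
    using attainedE[OF assms(1,3)] by blast
  obtain \<psi> where \<psi>: "integrable lebesgue \<psi>" "avg \<psi> J = f" "level_set \<psi> J l = J"
    "avg (\<lambda>x. \<bar>\<psi> x\<bar>) J \<le> F + sqrt l * (1 - p + e)"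
    using raise_level[OF J \<phi>(1) assms(2,4)] \<phi> by metis
  show ?thesis
    using that[OF _ \<psi>(4)] attainedI[OF assms(1) \<psi>(1), of l] \<psi> ivl_measure_pos[OF J] by simp
qed

text \<open>The function \<open>\<phi>\<close> is replaced by \<open>(1 + d) * max \<phi> 0\<close> and diluted with the zero function to
  restore the mean \<open>f\<close>. By the weak-type bound the square function of the negative part of \<open>\<phi>\<close> is
  small off a small set.\<close>

lemma attained_boundary:
  assumes Jd: "J \<in> dyadic" and l: "0 < l" and f: "0 < f" and d: "0 < d"
    and att: "attained J l f p F" and F: "F \<le> f + 2 * d\<^sup>2"
  obtains q where "attained J l f q f"
    "f / ((1 + d) * (f + d\<^sup>2)) * (p - 4 * d * (1 + d) / sqrt l) \<le> q"
proof -
  have J: "ivl J" using Jd dyadic_imp_ivl by blast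
  obtain \<phi> where \<phi>: "integrable lebesgue \<phi>" "avg \<phi> J = f" "avg (\<lambda>x. \<bar>\<phi> x\<bar>) J = F"
    "measure lebesgue (level_set \<phi> J l) / measure lebesgue J = p"
    using attainedE[OF Jd att] by blast
  \<comment> \<open>\<open>u\<close> is the positive part and \<open>v\<close> is minus the negative
    part, so \<open>\<phi>\<close> is their sum and \<open>v\<close> has absolute mean
    \<open>(F - f) / 2\<close>, at most \<open>d\<^sup>2\<close>.\<close>
  define u where "u x = (\<bar>\<phi> x\<bar> + \<phi> x) / 2" for x
  define v where "v x = (\<phi> x - \<bar>\<phi> x\<bar>) / 2" for x
  have uv: "integrable lebesgue u" "integrable lebesgue v" using \<phi>(1) by (simp_all add: u_def[abs_def] v_def[abs_def])
  have \<phi>_eq: "(\<lambda>x. u x + v x) = \<phi>" by (auto simp: u_def v_def field_simps)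
  have Ff: "f \<le> F" using attained_bounds[OF Jd att] by simp
  have abs_int: "integrable lebesgue (\<lambda>x. \<bar>\<phi> x\<bar>)" using \<phi>(1) by simp
  have au: "avg u J = (F + f) / 2"
  proof -
    have "u = (\<lambda>x. (1/2) * (\<bar>\<phi> x\<bar> + \<phi> x))" by (auto simp: u_def)
    then have "avg u J = (1/2) * avg (\<lambda>x. \<bar>\<phi> x\<bar> + \<phi> x) J" by (simp only: avg_mult)
    then show ?thesis using avg_add[OF abs_int \<phi>(1) ivl_sets[OF J]] \<phi> by simp
  qed
  have av: "avg (\<lambda>x. \<bar>v x\<bar>) J = (F - f) / 2"
  proof -
    have "(\<lambda>x. \<bar>v x\<bar>) = (\<lambda>x. \<bar>\<phi> x\<bar> + (-1) * u x)" by (auto simp: u_def v_def field_simps)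
    then have "avg (\<lambda>x. \<bar>v x\<bar>) J = avg (\<lambda>x. \<bar>\<phi> x\<bar>) J + avg (\<lambda>x. (-1) * u x) J"
      using uv by (simp only:) (intro avg_add abs_int integrable_mult_right ivl_sets J)
    then show ?thesis using avg_mult[of "-1" u J] \<phi> au by (simp add: field_simps)
  qed
  \<comment> \<open>The factor \<open>1 + d\<close> offsets the loss in
    \<open>sq_sup_add_le\<close>: below level \<open>l\<close> for \<open>w\<close>, the term of
    \<open>u\<close> in that bound is less than \<open>l / (1 + d)\<close>.\<close>
  define w where "w x = (1 + d) * u x" for x
  have w: "integrable lebesgue w" using uv by (simp add: w_def[abs_def])
  define m where "m = (1 + d) * ((F + f) / 2)"
  have mw: "avg w J = m" unfolding w_def[abs_def] avg_mult au m_def by (rule refl)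
  have wabs: "\<bar>w x\<bar> = w x" for x using d by (simp add: w_def u_def)
  have mF: "f \<le> m" "m \<le> (1 + d) * (f + d\<^sup>2)"
  proof -
    have "1 * f \<le> (1 + d) * ((F + f) / 2)" using d f Ff by (intro mult_mono) auto
    then show "f \<le> m" by (simp add: m_def)
    show "m \<le> (1 + d) * (f + d\<^sup>2)" unfolding m_def using d F by (intro mult_left_mono) auto
  qed
  have m_pos: "0 < m" using mF f by simp
  \<comment> \<open>Chosen so that \<open>(1 + 1 / d) * l'\<close> is the remaining
    \<open>l * d / (1 + d)\<close>, which makes the two contributions add up to
    \<open>l\<close>.\<close>
  define l' where "l' = l * (d / (1 + d))\<^sup>2"
  have l': "0 < l'" "sqrt l' = sqrt l * (d / (1 + d))"
    using l d by (simp_all add: l'_def real_sqrt_mult)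
  define r where "r \<psi> k = measure lebesgue (level_set \<psi> J k) / measure lebesgue J" for \<psi> k
  have sub: "level_set \<phi> J l \<subseteq> level_set w J l \<union> level_set v J l'"
  proof
    fix x assume x: "x \<in> level_set \<phi> J l"
    show "x \<in> level_set w J l \<union> level_set v J l'"
    proof (rule ccontr)
      assume "x \<notin> level_set w J l \<union> level_set v J l'"
      then have wl: "sq_sup w J x < ennreal l" and vl: "sq_sup v J x < ennreal l'"
        using x by (auto simp: level_set_def)
      have wu: "sq_sup w J x = ennreal ((1 + d)\<^sup>2) * sq_sup u J x" unfolding w_def by (rule sq_sup_mult)
      have "sq_sup u J x \<noteq> top"
      proof
        assume "sq_sup u J x = top"
        then have "sq_sup w J x = top" using d by (simp add: wu ennreal_mult_top)
        then show False using wl by simp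
      qed
      then obtain a where a: "0 \<le> a" "sq_sup u J x = ennreal a" by (cases "sq_sup u J x") auto
      obtain b where b: "0 \<le> b" "sq_sup v J x = ennreal b" using vl by (cases "sq_sup v J x") auto
      have al: "(1 + d)\<^sup>2 * a < l" using wl a d unfolding wu by (simp add: ennreal_mult[symmetric] ennreal_less_iff)
      have bl: "b < l'" using vl b by (simp add: ennreal_less_iff)
      have "ennreal l \<le> sq_sup (\<lambda>x. u x + v x) J x" using x by (simp add: level_set_def \<phi>_eq)
      also have "\<dots> \<le> ennreal (1 + d) * sq_sup u J x + ennreal (1 + 1 / d) * sq_sup v J x"
        using uv J d by (rule sq_sup_add_le)
      also have "\<dots> = ennreal ((1 + d) * a + (1 + 1 / d) * b)"
        unfolding a(2) b(2) using a b d by (simp add: ennreal_mult ennreal_plus)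
      finally have le: "ennreal l \<le> ennreal ((1 + d) * a + (1 + 1 / d) * b)" .
      have "0 \<le> (1 + d) * a + (1 + 1 / d) * b" using a b d by simp
      then have "l \<le> (1 + d) * a + (1 + 1 / d) * b" using le by (rule ennreal_le_iff[THEN iffD1])
      moreover have "(1 + d) * a < l / (1 + d)" using al d by (simp add: field_simps power2_eq_square)
      moreover have "(1 + 1 / d) * b < (1 + 1 / d) * l'" using bl d by (intro mult_strict_left_mono add_pos_pos) auto
      moreover have "(1 + 1 / d) * l' = l * d / (1 + d)"
      proof -
        have "c / d * (l * (d / c)\<^sup>2) = l * d / c" if "0 < c" for c
          using d that by (simp add: power2_eq_square)
        from this[of "1 + d"] show ?thesis using d by (simp add: l'_def add_divide_distrib add.commute)
      qed
      moreover have "l / (1 + d) + l * d / (1 + d) = l"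
      proof -
        have "l / (1 + d) + l * d / (1 + d) = l * (1 + d) / (1 + d)"
          by (simp add: distrib_left add_divide_distrib)
        then show ?thesis using d by simp
      qed
      ultimately show False by linarith
    qed
  qed
  have lm: "level_set \<psi> J k \<in> lmeasurable" for \<psi> k
    using fmeasurableI2[OF ivl_lmeasurable[OF J] level_set_subset level_set_sets[OF J]] .
  have "measure lebesgue (level_set \<phi> J l) \<le> measure lebesgue (level_set w J l \<union> level_set v J l')"
    using sub lm by (intro measure_mono_fmeasurable fmeasurable.Un fmeasurableD)
  also have "\<dots> \<le> measure lebesgue (level_set w J l) + measure lebesgue (level_set v J l')"
    using J by (intro measure_Un_le) auto
  finally have "p \<le> r w l + r v l'"
    using \<phi>(4) ivl_measure_pos[OF J] by (auto simp: r_def divide_simps)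
  moreover have "r v l' \<le> 4 * d * (1 + d) / sqrt l"
  proof -
    \<comment> \<open>The absolute mean of \<open>v\<close> is quadratic in \<open>d\<close> while
      \<open>sqrt l'\<close> is of first order, so the exceptional set vanishes as \<open>d\<close>
      tends to \<open>0\<close>.\<close>
    have "r v l' \<le> 4 * avg (\<lambda>x. \<bar>v x\<bar>) J / sqrt l'" unfolding r_def using uv(2) J l'(1) by (rule weak_type)
    also have "\<dots> \<le> 4 * d\<^sup>2 / sqrt l'" using F l d l' by (intro divide_right_mono) (auto simp: av)
    also have "\<dots> = 4 * d * (1 + d) / sqrt l" unfolding l' using d l by (simp add: field_simps power2_eq_square)
    finally show ?thesis .
  qed
  ultimately have rw: "p - 4 * d * (1 + d) / sqrt l \<le> r w l" by linarith
  have \<theta>: "0 \<le> f / m" "f / m \<le> 1" using mF m_pos f by auto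
  \<comment> \<open>The means of \<open>w\<close> and of the zero function differ, so only the lower
    bound for the level is available. As \<open>w\<close> is nonnegative, mean and absolute mean are
    both brought down to \<open>f\<close>.\<close>
  obtain \<psi> where \<psi>: "integrable lebesgue \<psi>" "avg \<psi> J = f / m * avg w J + (1 - f / m) * avg (\<lambda>x. 0) J"
    "avg (\<lambda>x. \<bar>\<psi> x\<bar>) J = f / m * avg (\<lambda>x. \<bar>w x\<bar>) J + (1 - f / m) * avg (\<lambda>x. \<bar>0\<bar>) J"
    "f / m * r w l + (1 - f / m) * r (\<lambda>x. 0) l \<le> r \<psi> l"
    using mixture[OF J w _ \<theta>, of "\<lambda>x. 0" l] unfolding r_def by auto
  have "attained J l f (r \<psi> l) f"
    using attainedI[OF Jd \<psi>(1), of l] \<psi>(2,3) m_pos J by (simp add: mw wabs avg_const r_def)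
  moreover have "f / ((1 + d) * (f + d\<^sup>2)) * (p - 4 * d * (1 + d) / sqrt l) \<le> r \<psi> l"
  proof -
    have "0 \<le> (1 - f / m) * r (\<lambda>x. 0) l" using \<theta> by (simp add: r_def)
    then have "f / m * r w l \<le> r \<psi> l" using \<psi>(4) by linarith
    moreover have "f / ((1 + d) * (f + d\<^sup>2)) * (p - 4 * d * (1 + d) / sqrt l) \<le> f / ((1 + d) * (f + d\<^sup>2)) * r w l"
      using rw f d by (intro mult_left_mono) auto
    moreover have "f / ((1 + d) * (f + d\<^sup>2)) * r w l \<le> f / m * r w l"
      using mF m_pos f d by (intro mult_right_mono divide_left_mono mult_pos_pos add_pos_nonneg) (auto simp: r_def)
    ultimately show ?thesis by linarith
  qed
  ultimately show ?thesis using that by blast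
qed

section \<open>Monotonicity and continuity of the attained pairs\<close>

lemma attained_ex:
  assumes "J \<in> dyadic" "0 < l" "\<bar>f\<bar> \<le> F"
  shows "\<exists>p. attained J l f p F"
proof -
  define h where "h = max (max (sqrt l) F) (\<bar>f\<bar> + 1)"
  have h: "sqrt l \<le> h" "F \<le> h" "\<bar>f\<bar> < h" by (auto simp: h_def)
  define \<theta> where "\<theta> = (F - \<bar>f\<bar>) / (h - \<bar>f\<bar>)"
  have \<theta>: "0 \<le> \<theta>" "\<theta> \<le> 1" using h assms by (simp_all add: \<theta>_def)
  have "\<theta> * h + (1 - \<theta>) * \<bar>f\<bar> = \<bar>f\<bar> + \<theta> * (h - \<bar>f\<bar>)" by (simp add: algebra_simps)
  also have "\<dots> = F" using h by (simp add: \<theta>_def)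
  finally show ?thesis
    using attained_convex[OF assms(1,2) attained_one[OF assms(1,2) h(1)] attained_const[OF assms(1,2)] \<theta>, of f] h
    by (metis less_imp_le)
qed

text \<open>Mixing in a high step of level \<open>1\<close> spends the additional \<open>F\<close>
  and cannot lower a level that is at most \<open>1\<close>.\<close>

lemma attained_grow:
  assumes Jd: "J \<in> dyadic" and l: "0 < l" and att: "attained J l f p F" and FG: "F \<le> G"
  obtains q where "attained J l f q G" "p \<le> q"
proof -
  define h where "h = max (sqrt l) (G + 1)"
  have b: "p \<le> 1" "\<bar>f\<bar> \<le> F" using attained_bounds[OF Jd att] by auto
  have h: "sqrt l \<le> h" "G < h" "\<bar>f\<bar> \<le> h" using b FG by (auto simp: h_def)
  define \<theta> where "\<theta> = (G - F) / (h - F)"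
  have \<theta>: "0 \<le> \<theta>" "\<theta> \<le> 1" using h FG by (simp_all add: \<theta>_def)
  have "\<theta> * h + (1 - \<theta>) * F = F + \<theta> * (h - F)" by (simp add: algebra_simps)
  also have "\<dots> = G" using h FG by (simp add: \<theta>_def)
  finally have "attained J l f (\<theta> * 1 + (1 - \<theta>) * p) G"
    using attained_convex[OF Jd l attained_one[OF Jd l h(1,3)] att \<theta>] by simp
  moreover have "p \<le> \<theta> * 1 + (1 - \<theta>) * p"
    using mult_left_mono[OF b(1) \<theta>(1)] by (simp add: algebra_simps)
  ultimately show ?thesis using that by blast
qed

text \<open>Too high a level is diluted with the constant, which is no more expensive; too low a
  level is mixed with its raised version. This supplies the exact \<open>p\<close> that
  \<open>bellman_L\<close> demands.\<close>

lemma attained_adjust_level: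
  assumes Jd: "J \<in> dyadic" and l: "0 < l" and att: "attained J l f q F" and p: "0 \<le> p" "p \<le> 1"
    and pq: "p \<le> q + e" and e: "0 < e"
  obtains G where "attained J l f p G" "G \<le> F + 2 * sqrt l * e"
proof (cases "p \<le> q")
  case True
  note b = attained_bounds[OF Jd att]
  define \<theta> where "\<theta> = (if q = 0 then 0 else p / q)"
  have \<theta>: "0 \<le> \<theta>" "\<theta> \<le> 1" "\<theta> * q = p" using True p b by (auto simp: \<theta>_def)
  have "attained J l f (\<theta> * q + (1 - \<theta>) * 0) (\<theta> * F + (1 - \<theta>) * \<bar>f\<bar>)"
    using attained_convex[OF Jd l att attained_const[OF Jd l] \<theta>(1,2)] .
  moreover have "\<theta> * F + (1 - \<theta>) * \<bar>f\<bar> \<le> F + 2 * sqrt l * e"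
  proof -
    have "(1 - \<theta>) * \<bar>f\<bar> \<le> (1 - \<theta>) * F" using \<theta> b by (intro mult_left_mono) auto
    moreover have "0 \<le> 2 * sqrt l * e" using l e by simp
    ultimately show ?thesis by (simp add: algebra_simps)
  qed
  ultimately show ?thesis using that \<theta> by simp
next
  case False
  obtain H where H: "attained J l f 1 H" "H \<le> F + sqrt l * (1 - q + e)"
    using attained_raise[OF Jd l att e] by blast
  have q1: "q < 1" using False p by simp
  \<comment> \<open>Raising fully costs about \<open>sqrt l * (1 - q)\<close>; the share
    \<open>\<theta>\<close> of it is \<open>sqrt l * (p - q)\<close>, at most
    \<open>sqrt l * e\<close>. The slack in \<open>attained_raise\<close> contributes at most the
    same amount again.\<close>
  define \<theta> where "\<theta> = (p - q) / (1 - q)"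
  have \<theta>: "0 \<le> \<theta>" "\<theta> \<le> 1" "\<theta> * (1 - q) = p - q" using False p q1 by (simp_all add: \<theta>_def)
  have lev: "\<theta> * 1 + (1 - \<theta>) * q = p" using \<theta>(3) by (simp add: algebra_simps)
  have "attained J l f p (\<theta> * H + (1 - \<theta>) * F)"
    using attained_convex[OF Jd l H(1) att \<theta>(1,2)] lev by simp
  moreover have "\<theta> * H + (1 - \<theta>) * F \<le> F + 2 * sqrt l * e"
  proof -
    have "\<theta> * H \<le> \<theta> * (F + sqrt l * (1 - q + e))" using H \<theta> by (intro mult_left_mono) auto
    also have "\<dots> = \<theta> * F + sqrt l * (p - q + \<theta> * e)" unfolding \<theta>(3)[symmetric] by (simp add: algebra_simps)
    also have "sqrt l * (p - q + \<theta> * e) \<le> sqrt l * (e + 1 * e)"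
      using l pq \<theta> e by (intro mult_left_mono add_mono mult_right_mono) auto
    finally show ?thesis by (simp add: algebra_simps)
  qed
  ultimately show ?thesis using that by blast
qed

text \<open>Above \<open>|f|\<close>, dilution with the constant removes the surplus
  \<open>G - F\<close> and costs a small proportion of the level. On the edge
  \<open>attained_boundary\<close> takes over; it needs a nonzero mean, so \<open>f = 0\<close> is
  treated apart.\<close>

lemma attained_shrink:
  assumes Jd: "J \<in> dyadic" and l: "0 < l" and fF: "\<bar>f\<bar> \<le> F" and p: "0 \<le> p"
    and near: "\<And>e. 0 < e \<Longrightarrow> \<exists>G. attained J l f p G \<and> G < F + e"
    and e: "0 < e"
  shows "\<exists>q. attained J l f q F \<and> p - e < q"
proof (cases "\<bar>f\<bar> < F")
  case True
  \<comment> \<open>With this tolerance the share \<open>1 - \<theta>\<close> of the constant,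
    \<open>(G - F) / (G - \<bar>f\<bar>)\<close>, is below \<open>e\<close>.\<close>
  define d where "d = e * (F - \<bar>f\<bar>)"
  have d: "0 < d" using True e by (simp add: d_def)
  obtain G where G: "attained J l f p G" "G < F + d" using near[OF d] by blast
  note b = attained_bounds[OF Jd G(1)]
  show ?thesis
  proof (cases "G \<le> F")
    case True
    then show ?thesis using attained_grow[OF Jd l G(1)] e by (metis add.commute less_add_same_cancel1 diff_less_eq order_less_le_trans)
  next
    case False
    define \<theta> where "\<theta> = (F - \<bar>f\<bar>) / (G - \<bar>f\<bar>)"
    have Gf: "0 < G - \<bar>f\<bar>" using False fF by simp
    have \<theta>: "0 \<le> \<theta>" "\<theta> \<le> 1" "\<theta> * (G - \<bar>f\<bar>) = F - \<bar>f\<bar>" using False fF Gf by (simp_all add: \<theta>_def)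
    have "attained J l f (\<theta> * p + (1 - \<theta>) * 0) (\<theta> * G + (1 - \<theta>) * \<bar>f\<bar>)"
      using attained_convex[OF Jd l G(1) attained_const[OF Jd l] \<theta>(1,2)] .
    moreover have "\<theta> * G + (1 - \<theta>) * \<bar>f\<bar> = F" using \<theta>(3) by (simp add: algebra_simps)
    moreover have "p - e < \<theta> * p"
    proof -
      have "(1 - \<theta>) * (G - \<bar>f\<bar>) = G - F" using \<theta>(3) by (simp add: algebra_simps)
      also have "\<dots> < e * (F - \<bar>f\<bar>)" using G(2) by (simp add: d_def)
      also have "\<dots> \<le> e * (G - \<bar>f\<bar>)" using False e by (intro mult_left_mono) auto
      finally have "1 - \<theta> < e" using Gf by simp
      moreover have "(1 - \<theta>) * p \<le> (1 - \<theta>) * 1" using \<theta> b by (intro mult_left_mono) auto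
      ultimately show ?thesis by (simp add: algebra_simps)
    qed
    ultimately show ?thesis by auto
  qed
next
  case False
  then have F: "F = \<bar>f\<bar>" using fF by simp
  have pos: "\<exists>q. attained J l g q g \<and> p - e < q"
    if g: "0 < g" and near: "\<And>e. 0 < e \<Longrightarrow> \<exists>G. attained J l g p G \<and> G < g + e" for g
  proof -
    \<comment> \<open>The lower bound of \<open>attained_boundary\<close> as a function of
      \<open>d\<close>; it is continuous at \<open>0\<close> with value \<open>p\<close>, so a small
      positive \<open>d\<close> loses less than \<open>e\<close>.\<close>
    define B where "B d = g / ((1 + d) * (g + d\<^sup>2)) * (p - 4 * d * (1 + d) / sqrt l)" for d
    have "isCont B 0" unfolding B_def using g l by (intro continuous_intros) auto
    then have "(B \<longlongrightarrow> B 0) (at_right 0)" by (simp add: isCont_def filterlim_at_split)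
    moreover have "B 0 = p" using g by (simp add: B_def)
    ultimately have "\<forall>\<^sub>F d in at_right 0. p - e < B d" using e order_tendstoD(1)[of B p "at_right 0" "p - e"] by simp
    moreover have "\<forall>\<^sub>F d in at_right (0::real). 0 < d" by (simp add: eventually_at_right_less)
    ultimately have "\<forall>\<^sub>F d in at_right 0. 0 < d \<and> p - e < B d" by eventually_elim simp
    then obtain d where d: "0 < d" "p - e < B d" using eventually_happens'[of "at_right (0::real)"] by auto
    obtain G where G: "attained J l g p G" "G < g + 2 * d\<^sup>2" using near[of "2 * d\<^sup>2"] d by auto
    obtain q where "attained J l g q g" "B d \<le> q"
      using attained_boundary[OF Jd l g d(1) G(1)] G(2) unfolding B_def by auto
    then show ?thesis using d by (meson order_less_le_trans)
  qed
  consider "0 < f" | "f < 0" | "f = 0" by linarith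
  then show ?thesis
  proof cases
    case 1
    then show ?thesis using pos[of f] near F by auto
  next
    case 2
    have "\<exists>G. attained J l (- f) p G \<and> G < - f + e" if "0 < e" for e
    proof -
      obtain G where "attained J l f p G" "G < F + e" using near[OF \<open>0 < e\<close>] by blast
      then show ?thesis using 2 F attained_uminus[OF Jd, of l f p G] by auto
    qed
    then obtain q where "attained J l (- f) q (- f)" "p - e < q" using pos[of "- f"] 2 by auto
    then show ?thesis using attained_uminus[OF Jd, of l "- f"] 2 F by auto
  next
    case 3
    \<comment> \<open>For mean zero, absolute means near \<open>0\<close> force \<open>p\<close>
      below \<open>e\<close> by the weak-type bound, so the zero level of the constant function
      suffices.\<close>
    have "p - e < 0"
    proof -
      have "0 < e * sqrt l / 4" using e l by simp
      then obtain G where G: "attained J l f p G" "G < e * sqrt l / 4" using near[of "e * sqrt l / 4"] F 3 by auto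
      obtain \<phi> where \<phi>: "integrable lebesgue \<phi>" "avg (\<lambda>x. \<bar>\<phi> x\<bar>) J = G"
        "measure lebesgue (level_set \<phi> J l) / measure lebesgue J = p"
        using attainedE[OF Jd G(1)] by blast
      have "p \<le> 4 * G / sqrt l" using weak_type[OF \<phi>(1) dyadic_imp_ivl[OF Jd] l] \<phi> by simp
      also have "\<dots> < e" using G(2) l by (simp add: field_simps)
      finally show ?thesis by simp
    qed
    then show ?thesis using attained_const[OF Jd l, of f] F by auto
  qed
qed

theorem theorem3p1:
  fixes J :: "real set"
  assumes "J \<in> dyadic"
  shows "(\<forall>f p l :: real. 0 \<le> p \<and> p \<le> 1 \<and> 0 < l \<longrightarrow>
            bellman_L J f p l = Inf {F. \<bar>f\<bar> \<le> F \<and> p \<le> bellman_M J f F l}) \<and>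
         (\<forall>f F l :: real. \<bar>f\<bar> \<le> F \<and> 0 < l \<longrightarrow>
            bellman_M J f F l = Sup {p \<in> {0..1}. bellman_L J f p l \<le> F})"
proof -
  \<comment> \<open>A function of level \<open>1\<close> is lowered to \<open>p\<close>; the
    tolerance \<open>1\<close> is immaterial because the level only goes down.\<close>
  have L_ne: "\<exists>F. attained J l f p F" if "0 \<le> p" "p \<le> 1" "0 < l" for f p l
    using attained_adjust_level[OF assms that(3) attained_one[OF assms that(3), of "max (sqrt l) \<bar>f\<bar>"] that(1,2), of f 1] that
    by auto
  have L_bdd: "bdd_below {F. attained J l f p F}" for l f p
    using attained_bounds(3)[OF assms] by (intro bdd_belowI[of _ "\<bar>f\<bar>"]) auto
  have L_le: "bellman_L J f p l \<le> F" if "attained J l f p F" for l f p F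
    unfolding bellman_L_eq using that L_bdd by (intro cInf_lower) auto
  have M_bdd: "bdd_above {p. attained J l f p F}" for l f F
    using attained_bounds(2)[OF assms] by (intro bdd_aboveI[of _ 1]) auto
  have M_ge: "p \<le> bellman_M J f F l" if "attained J l f p F" for l f p F
    unfolding bellman_M_eq using that M_bdd by (intro cSup_upper) auto
  have 1: "bellman_L J f p l = Inf {F. \<bar>f\<bar> \<le> F \<and> p \<le> bellman_M J f F l}"
    if p: "0 \<le> p" "p \<le> 1" and l: "0 < l" for f p l
  proof (rule antisym)
    have "{F. attained J l f p F} \<noteq> {}" using L_ne[OF p l] by auto
    moreover have sub: "{F. attained J l f p F} \<subseteq> {F. \<bar>f\<bar> \<le> F \<and> p \<le> bellman_M J f F l}"
      using attained_bounds(3)[OF assms] M_ge by auto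
    ultimately show "Inf {F. \<bar>f\<bar> \<le> F \<and> p \<le> bellman_M J f F l} \<le> bellman_L J f p l"
      unfolding bellman_L_eq by (intro cInf_superset_mono) (auto intro: bdd_belowI[of _ "\<bar>f\<bar>"])
    show "bellman_L J f p l \<le> Inf {F. \<bar>f\<bar> \<le> F \<and> p \<le> bellman_M J f F l}"
    proof (rule cInf_greatest)
      show "{F. \<bar>f\<bar> \<le> F \<and> p \<le> bellman_M J f F l} \<noteq> {}" using sub L_ne[OF p l] by blast
      fix F assume F: "F \<in> {F. \<bar>f\<bar> \<le> F \<and> p \<le> bellman_M J f F l}"
      have "bellman_L J f p l \<le> F + d" if d: "0 < d" for d
      proof -
        \<comment> \<open>Cancels the constant \<open>2 * sqrt l\<close> of
          \<open>attained_adjust_level\<close>.\<close>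
        define e where "e = d / (2 * sqrt l)"
        have e: "0 < e" "2 * sqrt l * e = d" using d l by (simp_all add: e_def)
        have ne: "{p. attained J l f p F} \<noteq> {}" using attained_ex[OF assms l] F by auto
        have "p - e < Sup {p. attained J l f p F}" using F e by (auto simp: bellman_M_eq)
        then obtain q where q: "attained J l f q F" "p - e < q"
          using less_cSup_iff[OF ne M_bdd] by auto
        obtain G where "attained J l f p G" "G \<le> F + 2 * sqrt l * e"
          using attained_adjust_level[OF assms l q(1) p _ e(1)] q(2) by auto
        then show ?thesis using L_le e by fastforce
      qed
      then show "bellman_L J f p l \<le> F" by (rule field_le_epsilon)
    qed
  qed
  have 2: "bellman_M J f F l = Sup {p \<in> {0..1}. bellman_L J f p l \<le> F}"
    if F: "\<bar>f\<bar> \<le> F" and l: "0 < l" for f F l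
  proof (rule antisym)
    have ne: "{p. attained J l f p F} \<noteq> {}" using attained_ex[OF assms l F] by auto
    have sub: "{p. attained J l f p F} \<subseteq> {p \<in> {0..1}. bellman_L J f p l \<le> F}"
      using attained_bounds(1,2)[OF assms] L_le by auto
    show "bellman_M J f F l \<le> Sup {p \<in> {0..1}. bellman_L J f p l \<le> F}"
      unfolding bellman_M_eq using ne sub by (intro cSup_subset_mono) (auto intro: bdd_aboveI[of _ 1])
    show "Sup {p \<in> {0..1}. bellman_L J f p l \<le> F} \<le> bellman_M J f F l"
    proof (rule cSup_least)
      show "{p \<in> {0..1}. bellman_L J f p l \<le> F} \<noteq> {}" using ne sub by blast
      fix p assume p: "p \<in> {p \<in> {0..1}. bellman_L J f p l \<le> F}"
      \<comment> \<open>The infimum may not be attained, so only values of \<open>G\<close> slightly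
        above \<open>F\<close> are at hand; \<open>attained_shrink\<close> brings them back to
        \<open>F\<close>.\<close>
      have near: "\<exists>G. attained J l f p G \<and> G < F + e" if "0 < e" for e
      proof -
        have "Inf {G. attained J l f p G} < F + e" using p that by (auto simp: bellman_L_eq)
        moreover have "{G. attained J l f p G} \<noteq> {}" using L_ne[of p l f] p l by auto
        ultimately show ?thesis using cInf_less_iff[OF _ L_bdd, of l f p "F + e"] by auto
      qed
      have "p \<le> bellman_M J f F l + e" if "0 < e" for e
      proof -
        obtain q where "attained J l f q F" "p - e < q"
          using attained_shrink[OF assms l F _ near \<open>0 < e\<close>] p by auto
        then show ?thesis using M_ge by fastforce
      qed
      then show "p \<le> bellman_M J f F l" by (rule field_le_epsilon)
    qed
  qed
  show ?thesis using 1 2 by blast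
qed

end
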